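(* Let $\alpha\in\mathbb{R}$, $1<p,q<\infty$, $0<\lambda<\min\{-\alpha+n/p',-\alpha+m/p'\}$, and $$\max\left\{-\frac np,-\frac mp\right\}<\alpha<\min\left\{n\left(1-\frac1p\right),m\left(1-\frac1p\right)\right\}.$$ Then the strong maximal operator $M_S$ is bounded on $B\vec{\dot K}_{p,q}^{\alpha,\lambda}(\mathbb{R}^n\times\mathbb{R}^m)$, i.e. there is a constant $C>0$ such that $\|M_Sf\|_{B\vec{\dot K}_{p,q}^{\alpha,\lambda}}\le C\|f\|_{B\vec{\dot K}_{p,q}^{\alpha,\lambda}}$ for all $f\in B\vec{\dot K}_{p,q}^{\alpha,\lambda}(\mathbb{R}^n\times\mathbb{R}^m)$.
   Context: $n,m$ are positive integers; $p'$ is the conjugate exponent of $p$. For $x\in\mathbb{R}^d$, $r>0$, $Q(x,r)$ is the cube centered at $x$ with side length $r$; $\mathcal{R}$ is the set of all rectangles $Q(x,r)\times Q(y,s)$, $x\in\mathbb{R}^n$, $y\in\mathbb{R}^m$, $r,s>0$. The strong maximal operator is $M_Sf(z)=\sup_{z\in R\in\mathcal{R}}\frac1{|R|}\int_R|f(z')|\,dz'$ for locally integrable $f$ on $\mathbb{R}^n\times\mathbb{R}^m$. For $k\in\mathbb{Z}$, $Q_k=Q(0,2^k)$ (in $\mathbb{R}^n$ or $\mathbb{R}^m$); $R_{i,j}=Q_i\times Q_j\subset\mathbb{R}^n\times\mathbb{R}^m$; $I_i=Q_i\setminus Q_{i-1}\subset\mathbb{R}^n$, $J_j=Q_j\setminus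 Q_{j-1}\subset\mathbb{R}^m$; $\chi_{i,j}$ is the characteristic function of $I_i\times J_j$. Product Herz norm: for measurable $f$, $$\|f\|_{\vec{\dot K}_{p,q}^{\alpha}}=\Big(\sum_{i,j\in\mathbb{Z}}2^{(i+j)q\alpha}\|f\chi_{i,j}\|_{L^p(\mathbb{R}^n\times\mathbb{R}^m)}^q\Big)^{1/q}.$$ A measurable function $b$ is a product Herz-block, $b\in b\vec{\dot K}_{p,q}^{\alpha,\lambda}$, if it is supported in some $R_{l_1,l_2}$ with $l_1,l_2\in\mathbb{Z}$ and $\|b\|_{\vec{\dot K}_{p,q}^{\alpha}}\le 2^{-\lambda(l_1+l_2)}$. The product block-Herz space $B\vec{\dot K}_{p,q}^{\alpha,\lambda}$ is the set of all $\sum_{k=1}^\infty\lambda_kb_k$ with $\sum_k|\lambda_k|<\infty$ and $b_k\in b\vec{\dot K}_{p,q}^{\alpha,\lambda}$ (such series converge absolutely almost everywhere), with norm $\|f\|_{B\vec{\dot K}_{p,q}^{\alpha,\lambda}}=\inf\{\sum_k|\lambda_k|\}$ over all such representations $f=\sum_k\lambda_kb_k$. *)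

theory Defs
  imports "HOL-Analysis.Analysis"
begin

text \<open>
  The underlying space is \<open>(real ^ 'n) \<times> (real ^ 'm)\<close> with \<open>n = CARD('n)\<close>, \<open>m = CARD('m)\<close> and Lebesgue
  measure.  Functions and scalars are complex.  Norms take values in \<open>ennreal\<close>, so that they are
  meaningful for every measurable function.
\<close>

text \<open>Cubes are closed; this affects the sets below only up to Lebesgue null sets, and does not
  affect the values of the maximal function.\<close>

definition cube :: "real ^ 'd \<Rightarrow> real \<Rightarrow> (real ^ 'd) set" where
  "cube x r = cbox (\<chi> i. x $ i - r / 2) (\<chi> i. x $ i + r / 2)"

definition dyadic_cube :: "int \<Rightarrow> (real ^ 'd) set" where
  "dyadic_cube k = cube 0 (2 powi k)"

definition dyadic_shell :: "int \<Rightarrow> (real ^ 'd) set" where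
  "dyadic_shell k = dyadic_cube k - dyadic_cube (k - 1)"

definition dyadic_rect :: "int \<Rightarrow> int \<Rightarrow> ((real ^ 'n) \<times> (real ^ 'm)) set" where
  "dyadic_rect i j = dyadic_cube i \<times> dyadic_cube j"

definition rectangles :: "((real ^ 'n) \<times> (real ^ 'm)) set set" where
  "rectangles = {cube x r \<times> cube y s | x y r s. r > 0 \<and> s > 0}"

definition strong_maximal ::
  "((real ^ 'n) \<times> (real ^ 'm) \<Rightarrow> complex) \<Rightarrow> (real ^ 'n) \<times> (real ^ 'm) \<Rightarrow> ennreal" where
  "strong_maximal f z =
     (SUP R \<in> {R \<in> rectangles. z \<in> R}.
        (\<integral>\<^sup>+ w \<in> R. ennreal (norm (f w)) \<partial>lebesgue) / emeasure lebesgue R)"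

text \<open>Real powers on \<open>[0, \<infinity>]\<close>, used only with positive exponents.\<close>

definition epowr :: "ennreal \<Rightarrow> real \<Rightarrow> ennreal" where
  "epowr x a = (if x = \<infinity> then \<infinity> else ennreal (enn2real x powr a))"

definition Lp_norm :: "real \<Rightarrow> ((real ^ 'n) \<times> (real ^ 'm) \<Rightarrow> complex) \<Rightarrow> ennreal" where
  "Lp_norm p f = epowr (\<integral>\<^sup>+ z. ennreal (norm (f z) powr p) \<partial>lebesgue) (1 / p)"

definition herz_norm ::
  "real \<Rightarrow> real \<Rightarrow> real \<Rightarrow> ((real ^ 'n) \<times> (real ^ 'm) \<Rightarrow> complex) \<Rightarrow> ennreal" where
  "herz_norm \<alpha> p q f =
     epowr (\<Sum>\<^sub>\<infinity>(i, j) \<in> UNIV.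
              ennreal (2 powr (real_of_int (i + j) * q * \<alpha>)) *
              epowr (Lp_norm p (\<lambda>z. f z * indicator (dyadic_shell i \<times> dyadic_shell j) z)) q)
           (1 / q)"

definition herz_block ::
  "real \<Rightarrow> real \<Rightarrow> real \<Rightarrow> real \<Rightarrow> ((real ^ 'n) \<times> (real ^ 'm) \<Rightarrow> complex) \<Rightarrow> bool" where
  "herz_block \<alpha> p q lam b \<longleftrightarrow>
     b \<in> borel_measurable lebesgue \<and>
     (\<exists>l1 l2. (\<forall>z. z \<notin> dyadic_rect l1 l2 \<longrightarrow> b z = 0) \<and>
              herz_norm \<alpha> p q b \<le> ennreal (2 powr (- lam * real_of_int (l1 + l2))))"

text \<open>\<open>block_rep \<alpha> p q lam f c b\<close>: the pair \<open>(c, b)\<close> represents \<open>f\<close> as a series of blocks.  The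
  series is summed almost everywhere, so functions are identified up to null sets.\<close>

definition block_rep ::
  "real \<Rightarrow> real \<Rightarrow> real \<Rightarrow> real \<Rightarrow> ((real ^ 'n) \<times> (real ^ 'm) \<Rightarrow> complex) \<Rightarrow>
   (nat \<Rightarrow> complex) \<Rightarrow> (nat \<Rightarrow> (real ^ 'n) \<times> (real ^ 'm) \<Rightarrow> complex) \<Rightarrow> bool" where
  "block_rep \<alpha> p q lam f c b \<longleftrightarrow>
     summable (\<lambda>k. norm (c k)) \<and> (\<forall>k. herz_block \<alpha> p q lam (b k)) \<and>
     (AE z in lebesgue. (\<lambda>k. c k * b k z) sums f z)"

definition block_herz ::
  "real \<Rightarrow> real \<Rightarrow> real \<Rightarrow> real \<Rightarrow> ((real ^ 'n) \<times> (real ^ 'm) \<Rightarrow> complex) set" where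
  "block_herz \<alpha> p q lam = {f. \<exists>c b. block_rep \<alpha> p q lam f c b}"

definition block_herz_norm ::
  "real \<Rightarrow> real \<Rightarrow> real \<Rightarrow> real \<Rightarrow> ((real ^ 'n) \<times> (real ^ 'm) \<Rightarrow> complex) \<Rightarrow> ennreal" where
  "block_herz_norm \<alpha> p q lam f =
     Inf {ennreal (\<Sum>k. norm (c k)) | c. \<exists>b. block_rep \<alpha> p q lam f c b}"

end

theory Submission
  imports Defs
begin

text \<open>
  Cut every block supported in \<open>dyadic_rect l1 l2\<close> into its restrictions \<open>g\<close> to the product shells
  \<open>(l1 - a, l2 - a')\<close>, \<open>a, a' \<ge> 0\<close>, and cut \<open>M\<^sub>S g\<close> along the shells \<open>(l1 - a + e, l2 - a' + e')\<close>.
  The operator \<open>M\<^sub>S\<close> is dominated by the cube maximal operators in the two variables applied one after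
  the other, and each of these maps \<open>L\<^sup>p\<close> of one shell to \<open>L\<^sup>p\<close> of the shell \<open>e\<close> steps further with a
  norm that decays geometrically in \<open>|e|\<close>: for \<open>|e| \<le> 1\<close> this is the Hardy-Littlewood theorem, and
  otherwise a cube meeting both shells has size comparable to the larger one.  Each resulting piece lives on a
  single shell and is therefore a multiple of a block; the multiples are bounded by
  \<open>2 powr (- lam (a + a'))\<close> times two-sided geometric sequences in \<open>e\<close> and \<open>e'\<close>, and they are summable
  because \<open>lam > 0\<close> and \<open>- n / p < \<alpha> + lam < n / p'\<close> (likewise for \<open>m\<close>).  The exponent \<open>q\<close> plays no role,
  since a single-shell function has only one term in its Herz norm.
\<close>

section \<open>Cubes and the maximal operator of cubes\<close>

text \<open>A function on the single shell (k, l) is a block as soon as its L^p norm is at most 2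
  powr (- (\<alpha> + lam) (k + l)). Measured against this, the restriction of a block to shell (l1
  - a, l2 - a') is small: its norm is controlled by the large rectangle (l1, l2), which gains 2 powr
  (- lam (a + a')). Moving a piece by e shells costs 2 powr ((\<alpha> + lam) e), and the decay of
  the maximal operator, 2 powr (- n e / p') outwards and 2 powr (n e / p) inwards (e < 0), must beat
  it; hence the two bounds on \<alpha> + lam. The obstacle is that M_S is only sublinear: cutting f
  gives a domination of M_S f by a series of nonnegative single-shell functions, not a
  representation. But blocks stay blocks when multiplied by a measurable function with values in
  [0, 1], and the quotient of M_S f by the dominating series is such a function, provided that
  series is finite almost everywhere, which needs its own argument. The estimates are therefore
  carried out for Borel functions with values in [0, \<infinity>].\<close>

lemma epowr_ennreal: "0 \<le> x \<Longrightarrow> epowr (ennreal x) a = ennreal (x powr a)"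
  by (simp add: epowr_def)

lemma epowr_top [simp]: "epowr top a = top"
  by (simp add: epowr_def)

lemma epowr_0 [simp]: "epowr 0 a = 0"
  by (simp add: epowr_def)

lemma epowr_mono: "0 \<le> a \<Longrightarrow> x \<le> y \<Longrightarrow> epowr x a \<le> epowr y a"
  by (cases x; cases y) (auto simp: epowr_ennreal top_unique intro!: ennreal_leI powr_mono2)

text \<open>Holds for every real \<open>a\<close>: \<open>epowr\<close> fixes both 0 and
  \<open>top\<close> whatever the sign of the exponent, so the convention 0 * \<infinity> = 0 is
  respected.\<close>

lemma epowr_mult: "epowr (x * y) a = epowr x a * epowr y a"
proof -
  have pos: "epowr (ennreal u) a = 0 \<longleftrightarrow> u = 0" if "0 \<le> u" for u
    using that by (simp add: epowr_ennreal)
  show ?thesis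
  proof (cases x)
    case x: (real r)
    show ?thesis
    proof (cases y)
      case (real s)
      then show ?thesis using x
        by (simp only: ennreal_mult[symmetric] epowr_ennreal mult_nonneg_nonneg powr_mult powr_ge_zero)
    next
      case top
      then show ?thesis using x pos[of r] by (cases "r = 0") (simp_all add: ennreal_mult_top)
    qed
  next
    case x: top
    show ?thesis
    proof (cases y)
      case (real s)
      then show ?thesis using x pos[of s] by (cases "s = 0") (simp_all add: ennreal_top_mult)
    next
      case top
      then show ?thesis using x by simp
    qed
  qed
qed

lemma epowr_epowr: "epowr (epowr x a) b = epowr x (a * b)"
  by (cases x) (auto simp: epowr_ennreal powr_powr)

lemma epowr_1 [simp]: "epowr x 1 = x"
  by (cases x) (auto simp: epowr_ennreal)

lemma epowr_measurable [measurable]: "(\<lambda>x. epowr x a) \<in> borel_measurable borel"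
  unfolding epowr_def by measurable

lemma ennreal_divide_le_iff:
  fixes a b t :: ennreal
  assumes "0 < b" "b < top"
  shows "a / b \<le> t \<longleftrightarrow> a \<le> t * b"
proof
  assume "a / b \<le> t"
  then have "a / b * b \<le> t * b" by (rule mult_right_mono) simp
  then show "a \<le> t * b" using assms
    by (simp add: ennreal_divide_times[symmetric] ennreal_divide_self mult.commute ennreal_times_divide
      mult_divide_eq_ennreal)
next
  assume "a \<le> t * b"
  then show "a / b \<le> t" using assms
    by (intro divide_le_posI_ennreal) (auto simp: mult.commute)
qed

lemma ennreal_less_divide_iff:
  fixes a b t :: ennreal
  assumes "0 < b" "b < top"
  shows "t < a / b \<longleftrightarrow> t * b < a"
  using ennreal_divide_le_iff[OF assms] by (simp add: not_le[symmetric])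

lemma mem_cube: "y \<in> cube x r \<longleftrightarrow> (\<forall>i. \<bar>y $ i - x $ i\<bar> \<le> r / 2)"
  unfolding cube_def mem_box_cart vec_lambda_beta by (intro all_cong1) argo

lemma cube_measurable [measurable]: "cube x r \<in> sets borel"
  by (simp add: cube_def)

lemma emeasure_cube:
  fixes x :: "real ^ 'd"
  assumes "0 \<le> r"
  shows "emeasure lborel (cube x r) = ennreal (r ^ CARD('d))"
proof -
  let ?a = "(\<chi> i. x $ i - r / 2)" and ?b = "(\<chi> i. x $ i + r / 2)"
  have "x \<in> cbox ?a ?b" using assms by (simp add: mem_box_cart)
  then have ne: "cbox ?a ?b \<noteq> {}" by blast
  have "emeasure lborel (cube x r) = ennreal (measure lborel (cbox ?a ?b))"
    unfolding cube_def using emeasure_lborel_cbox_finite[of ?a ?b] by (simp add: emeasure_eq_ennreal_measure)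
  also have "measure lborel (cbox ?a ?b) = r ^ CARD('d)"
    using content_cbox_cart[OF ne] by simp
  finally show ?thesis .
qed

lemma emeasure_cube_pos:
  fixes x :: "real ^ 'd"
  assumes "0 < r"
  shows "0 < emeasure lborel (cube x r)" and "emeasure lborel (cube x r) < top"
  using assms by (simp_all add: emeasure_cube)

lemma vec_nth_dist_le: "\<bar>x $ i - y $ i\<bar> \<le> dist x y" for x y :: "real ^ 'd"
  using component_le_norm_cart[of "x - y" i] by (simp add: dist_norm)

text \<open>The uncentred Hardy-Littlewood maximal function. Values in [0, \<infinity>] allow it to
  act, in one variable, on a function that is itself a maximal function in the other and may be
  infinite.\<close>

definition cube_maximal :: "(real ^ 'd \<Rightarrow> ennreal) \<Rightarrow> real ^ 'd \<Rightarrow> ennreal" where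
  "cube_maximal g x = (SUP Q \<in> {Q. \<exists>c r. Q = cube c r \<and> 0 < r \<and> x \<in> Q}.
     (\<integral>\<^sup>+ w \<in> Q. g w \<partial>lborel) / emeasure lborel Q)"

lemma less_cube_maximal_iff:
  "t < cube_maximal g x \<longleftrightarrow>
    (\<exists>c r. 0 < r \<and> x \<in> cube c r \<and> t * emeasure lborel (cube c r) < (\<integral>\<^sup>+ w \<in> cube c r. g w \<partial>lborel))"
proof -
  have *: "t < (\<integral>\<^sup>+ w \<in> cube c r. g w \<partial>lborel) / emeasure lborel (cube c r) \<longleftrightarrow>
      t * emeasure lborel (cube c r) < (\<integral>\<^sup>+ w \<in> cube c r. g w \<partial>lborel)" if "0 < r" for c :: "real ^ 'a" and r
    by (rule ennreal_less_divide_iff[OF emeasure_cube_pos[OF that]])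
  show ?thesis
    unfolding cube_maximal_def less_SUP_iff using * by blast
qed

lemma cube_average_le_maximal:
  assumes "0 < r" "x \<in> cube c r"
  shows "(\<integral>\<^sup>+ w \<in> cube c r. g w \<partial>lborel) / emeasure lborel (cube c r) \<le> cube_maximal g x"
  unfolding cube_maximal_def using assms by (intro SUP_upper) auto

text \<open>A strict bound leaves room: by continuity of the volume it survives a slight
  enlargement. The reduction to countably many cubes and the openness of level sets both rest on
  this.\<close>

lemma ex_larger_factor:
  fixes a :: ennreal and v :: "real \<Rightarrow> real"
  assumes "t * ennreal (v r) < a" "0 < v r" "isCont v r"
  obtains e where "0 < e" "\<And>r'. r < r' \<Longrightarrow> r' < r + e \<Longrightarrow> t * ennreal (v r') < a"
proof -
  \<comment> \<open>If \<open>t\<close> were \<open>top\<close>, so would be the product, and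
    nothing exceeds \<open>top\<close>. Multiplication by a finite constant is continuous on
    [0, \<infinity>].\<close>
  have "t \<noteq> top" using assms(1,2) by (auto simp: ennreal_top_mult)
  then have *: "((\<lambda>s. t * ennreal (v s)) \<longlongrightarrow> t * ennreal (v r)) (at r)"
    using assms(2,3) by (intro ennreal_tendsto_cmult tendsto_ennrealI) (auto simp: isCont_def less_top)
  have "\<forall>\<^sub>F s in at r. t * ennreal (v s) < a"
    using order_tendstoD(2)[OF * assms(1)] .
  then obtain e where "e > 0" "\<And>s. s \<noteq> r \<Longrightarrow> dist s r < e \<Longrightarrow> t * ennreal (v s) < a"
    unfolding eventually_at by auto
  then show ?thesis by (intro that[of e]) (auto simp: dist_real_def)
qed

text \<open>Every cube that witnesses a level set can be enlarged to one with rational side and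
  centre in a countable dense set. The family \<open>K\<close> is chosen before \<open>g\<close>,
  \<open>t\<close> and \<open>x\<close>; measurability in a parameter depends on that.\<close>

lemma countable_cubes:
  "\<exists>K :: ((real ^ 'd) \<times> real) set. countable K \<and> K \<subseteq> UNIV \<times> {0<..} \<and>
    (\<forall>g t x. t < cube_maximal g x \<longleftrightarrow>
      (\<exists>(c, r) \<in> K. x \<in> cube c r \<and> t * emeasure lborel (cube c r) < (\<integral>\<^sup>+ w \<in> cube c r. g w \<partial>lborel)))"
proof -
  obtain D :: "(real ^ 'd) set" where D: "countable D" "\<And>X. open X \<Longrightarrow> X \<noteq> {} \<Longrightarrow> \<exists>d\<in>D. d \<in> X"
    using countable_dense_setE by blast
  define K where "K = D \<times> {r \<in> \<rat>. (0::real) < r}"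
  have 3: "countable K"
    unfolding K_def by (intro countable_SIGMA D(1) countable_subset[OF _ countable_rat]) auto
  have 4: "K \<subseteq> UNIV \<times> {0<..}" by (auto simp: K_def)
  have 1: "(\<exists>(c, r) \<in> K. x \<in> cube c r \<and> t * emeasure lborel (cube c r) < (\<integral>\<^sup>+ w \<in> cube c r. g w \<partial>lborel))"
    if lt: "t < cube_maximal g x" for g t x
  proof -
    obtain c r where cr: "0 < r" "x \<in> cube c r"
      "t * emeasure lborel (cube c r) < (\<integral>\<^sup>+ w \<in> cube c r. g w \<partial>lborel)"
      using lt unfolding less_cube_maximal_iff by blast
    let ?I = "\<integral>\<^sup>+ w \<in> cube c r. g w \<partial>lborel"
    obtain e where e: "0 < e" "\<And>r'. r < r' \<Longrightarrow> r' < r + e \<Longrightarrow> t * ennreal (r' ^ CARD('d)) < ?I"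
      using ex_larger_factor[of t "\<lambda>r. r ^ CARD('d)" r ?I] cr by (auto simp: emeasure_cube)
    obtain \<rho> where \<rho>: "\<rho> \<in> \<rat>" "r < \<rho>" "\<rho> < r + e"
      using Rats_dense_in_real[of r "r + e"] e(1) by auto
    \<comment> \<open>The side grows by \<open>\<rho> - r\<close>, so the centre may move by half of
      that in each coordinate while the old cube stays inside.\<close>
    obtain d where d: "d \<in> D" "d \<in> ball c ((\<rho> - r) / 2)"
      using D(2)[of "ball c ((\<rho> - r) / 2)"] \<rho> by auto
    have sub: "cube c r \<subseteq> cube d \<rho>"
    proof
      fix y assume y: "y \<in> cube c r"
      show "y \<in> cube d \<rho>"
        unfolding mem_cube
      proof
        fix i
        have "\<bar>y $ i - c $ i\<bar> \<le> r / 2" using y by (simp add: mem_cube)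
        moreover have "\<bar>c $ i - d $ i\<bar> < (\<rho> - r) / 2"
          using vec_nth_dist_le[of c i d] d(2) by simp
        ultimately show "\<bar>y $ i - d $ i\<bar> \<le> \<rho> / 2" unfolding abs_le_iff abs_less_iff by argo
      qed
    qed
    have "t * emeasure lborel (cube d \<rho>) < ?I"
      using e(2)[OF \<rho>(2,3)] \<rho>(2) cr(1) by (simp add: emeasure_cube)
    also have "?I \<le> (\<integral>\<^sup>+ w \<in> cube d \<rho>. g w \<partial>lborel)"
      using sub by (intro nn_integral_mono mult_left_mono) (auto simp: indicator_def)
    finally show ?thesis using sub cr(1,2) \<rho> d(1) by (intro bexI[of _ "(d, \<rho>)"]) (auto simp: K_def)
  qed
  have 2: "t < cube_maximal g x"
    if "\<exists>(c, r) \<in> K. x \<in> cube c r \<and> t * emeasure lborel (cube c r) < (\<integral>\<^sup>+ w \<in> cube c r. g w \<partial>lborel)" for g t x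
    unfolding less_cube_maximal_iff using that by (auto simp: K_def)
  show ?thesis
    by (intro exI[of _ K] conjI 3 4 allI iffI) (erule 1, erule 2)
qed

text \<open>A supremum over the fixed countable family of cubes, each average depending measurably
  on the parameter by Tonelli. The joint form serves the iterated operator, where one variable is
  the parameter of the other.\<close>

lemma cube_maximal_measurable_param:
  fixes g :: "'a \<Rightarrow> real ^ 'd \<Rightarrow> ennreal"
  assumes g[measurable]: "case_prod g \<in> borel_measurable (M \<Otimes>\<^sub>M borel)"
  shows "(\<lambda>(w, x). cube_maximal (g w) x) \<in> borel_measurable (M \<Otimes>\<^sub>M borel)"
proof -
  obtain K :: "((real ^ 'd) \<times> real) set" where K': "countable K \<and> K \<subseteq> UNIV \<times> {0<..} \<and>
    (\<forall>g t x. t < cube_maximal g x \<longleftrightarrow>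
      (\<exists>(c, r) \<in> K. x \<in> cube c r \<and> t * emeasure lborel (cube c r) < (\<integral>\<^sup>+ w \<in> cube c r. g w \<partial>lborel)))"
    using countable_cubes by (rule exE)
  note K = conjunct1[OF K'] conjunct1[OF conjunct2[OF K']] conjunct2[OF conjunct2[OF K'], rule_format]
  let ?F = "\<lambda>k w x. indicator (cube (fst k) (snd k)) x *
      ((\<integral>\<^sup>+ v \<in> cube (fst k) (snd k). g w v \<partial>lborel) / emeasure lborel (cube (fst k) (snd k)))"
  have eq: "cube_maximal (g w) x = (SUP k\<in>K. ?F k w x)" for w x
  proof (rule antisym)
    show "cube_maximal (g w) x \<le> (SUP k\<in>K. ?F k w x)"
    proof (rule dense_le)
      fix t assume "t < cube_maximal (g w) x"
      then obtain k where k: "k \<in> K" "x \<in> cube (fst k) (snd k)"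
        "t * emeasure lborel (cube (fst k) (snd k)) < (\<integral>\<^sup>+ v \<in> cube (fst k) (snd k). g w v \<partial>lborel)"
        unfolding K(3) by auto
      have "t < ?F k w x"
      proof -
        have "0 < snd k" using k(1) K(2) by auto
        from ennreal_less_divide_iff[OF emeasure_cube_pos[OF this, of "fst k"]] k(2,3)
        show ?thesis by simp
      qed
      also have "\<dots> \<le> (SUP k\<in>K. ?F k w x)" using k(1) by (rule SUP_upper)
      finally show "t \<le> (SUP k\<in>K. ?F k w x)" by simp
    qed
    show "(SUP k\<in>K. ?F k w x) \<le> cube_maximal (g w) x"
    proof (rule SUP_least)
      fix k assume "k \<in> K"
      then have "0 < snd k" using K(2) by auto
      then show "?F k w x \<le> cube_maximal (g w) x"
        using cube_average_le_maximal[of "snd k" x "fst k" "g w"]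
        by (cases "x \<in> cube (fst k) (snd k)") simp_all
    qed
  qed
  have g'[measurable]: "(\<lambda>z. g (fst z) (snd z)) \<in> borel_measurable (M \<Otimes>\<^sub>M borel)"
    using g by (simp add: case_prod_beta')
  have m: "(\<lambda>w. \<integral>\<^sup>+ v \<in> A. g w v \<partial>lborel) \<in> borel_measurable M" if [measurable]: "A \<in> sets borel" for A
    by (rule lborel.borel_measurable_nn_integral) (unfold case_prod_beta', measurable)
  have "(\<lambda>z. ?F k (fst z) (snd z)) \<in> borel_measurable (M \<Otimes>\<^sub>M borel)" if "k \<in> K" for k
  proof -
    note m[OF cube_measurable, of "fst k" "snd k", measurable]
    show ?thesis by measurable
  qed
  then show ?thesis unfolding case_prod_beta' eq by (rule borel_measurable_SUP[OF K(1)])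
qed

lemma cube_maximal_measurable [measurable]:
  assumes [measurable]: "g \<in> borel_measurable borel"
  shows "cube_maximal g \<in> borel_measurable borel"
proof -
  have "(\<lambda>(w, x). cube_maximal ((\<lambda>_::unit. g) w) x) \<in> borel_measurable (count_space UNIV \<Otimes>\<^sub>M borel)"
    by (rule cube_maximal_measurable_param) simp
  from measurable_compose[OF measurable_Pair1' this, of "()"] show ?thesis by simp
qed

section \<open>The weak type and strong type estimates\<close>

text \<open>Vitali's greedy selection: every cube that meets a largest one lies in the triple of it.
  Keep the largest, drop all cubes that meet it, and continue with the rest.\<close>

lemma finite_cube_covering:
  fixes F :: "((real ^ 'd) \<times> real) set"
  assumes "finite F" "F \<subseteq> UNIV \<times> {0<..}"
  shows "\<exists>G\<subseteq>F. disjoint_family_on (\<lambda>k. cube (fst k) (snd k)) G \<and>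
    (\<Union>k\<in>F. cube (fst k) (snd k)) \<subseteq> (\<Union>k\<in>G. cube (fst k) (3 * snd k))"
  using assms
proof (induction F rule: finite_psubset_induct)
  case (psubset F)
  show ?case
  proof (cases "F = {}")
    case True
    then show ?thesis by (auto simp: disjoint_family_on_def)
  next
    case False
    let ?Q = "\<lambda>k. cube (fst k) (snd k)"
    have "Max (snd ` F) \<in> snd ` F" using False psubset.hyps by (intro Max_in) auto
    then obtain k where k: "k \<in> F" "snd k = Max (snd ` F)" by fastforce
    have max: "snd l \<le> snd k" if "l \<in> F" for l
      using that psubset.hyps unfolding k(2) by (intro Max_ge) auto
    have pos: "0 < snd l" if "l \<in> F" for l
      using that psubset.prems by auto
    define F' where "F' = {l \<in> F. ?Q l \<inter> ?Q k = {}}"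
    have "fst k \<in> ?Q k" using pos[OF k(1)] by (simp add: mem_cube)
    then have "F' \<subset> F" using k(1) by (auto simp: F'_def)
    moreover have "F' \<subseteq> UNIV \<times> {0<..}" using psubset.prems by (auto simp: F'_def)
    ultimately obtain G where G: "G \<subseteq> F'" "disjoint_family_on ?Q G"
        "(\<Union>k\<in>F'. ?Q k) \<subseteq> (\<Union>k\<in>G. cube (fst k) (3 * snd k))"
      using psubset.IH by meson
    have "?Q l \<subseteq> cube (fst k) (3 * snd k)" if l: "l \<in> F" "l \<notin> F'" for l
    proof
      fix y assume y: "y \<in> ?Q l"
      obtain u where u: "u \<in> ?Q l" "u \<in> ?Q k" using l by (auto simp: F'_def)
      show "y \<in> cube (fst k) (3 * snd k)"
        unfolding mem_cube
      proof
        fix i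
        have "\<bar>y $ i - fst l $ i\<bar> \<le> snd l / 2" "\<bar>u $ i - fst l $ i\<bar> \<le> snd l / 2"
          "\<bar>u $ i - fst k $ i\<bar> \<le> snd k / 2" "snd l \<le> snd k"
          using y u max[OF l(1)] by (auto simp: mem_cube)
        then show "\<bar>y $ i - fst k $ i\<bar> \<le> 3 * snd k / 2" unfolding abs_le_iff by argo
      qed
    qed
    then have "(\<Union>k\<in>F. ?Q k) \<subseteq> (\<Union>k\<in>insert k G. cube (fst k) (3 * snd k))"
      using G(3) by blast
    moreover have "disjoint_family_on ?Q (insert k G)"
      using G(1,2) unfolding disjoint_family_on_def F'_def by blast
    moreover have "insert k G \<subseteq> F" using k(1) G(1) \<open>F' \<subset> F\<close> by blast
    ultimately show ?thesis by blast
  qed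
qed

text \<open>The factor 3^d is the volume ratio of the tripled cubes; as the selected cubes are
  disjoint, their masses under \<open>density lborel g\<close> add up to at most the whole
  integral.\<close>

lemma weak_type_finite:
  fixes g :: "real ^ 'd \<Rightarrow> ennreal"
  assumes [measurable]: "g \<in> borel_measurable borel"
    and F: "finite F" "F \<subseteq> UNIV \<times> {0<..}"
    and t: "\<And>k. k \<in> F \<Longrightarrow> t * emeasure lborel (cube (fst k) (snd k)) \<le> (\<integral>\<^sup>+ w \<in> cube (fst k) (snd k). g w \<partial>lborel)"
  shows "t * emeasure lborel (\<Union>k\<in>F. cube (fst k) (snd k)) \<le> 3 ^ CARD('d) * (\<integral>\<^sup>+ w. g w \<partial>lborel)"
proof -
  let ?Q = "\<lambda>k. cube (fst k) (snd k)"
  obtain G where G: "G \<subseteq> F" "disjoint_family_on ?Q G"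
    "(\<Union>k\<in>F. ?Q k) \<subseteq> (\<Union>k\<in>G. cube (fst k) (3 * snd k))"
    using finite_cube_covering[OF F] by blast
  have fin: "finite G" using G(1) F(1) by (rule finite_subset)
  have "t * emeasure lborel (\<Union>k\<in>F. ?Q k) \<le> t * emeasure lborel (\<Union>k\<in>G. cube (fst k) (3 * snd k))"
    using fin by (intro mult_left_mono emeasure_mono G(3)) auto
  also have "\<dots> \<le> t * (\<Sum>k\<in>G. emeasure lborel (cube (fst k) (3 * snd k)))"
    using fin by (intro mult_left_mono emeasure_subadditive_finite) auto
  also have "\<dots> = t * (\<Sum>k\<in>G. 3 ^ CARD('d) * emeasure lborel (?Q k))"
  proof -
    have "emeasure lborel (cube (fst k) (3 * snd k)) = 3 ^ CARD('d) * emeasure lborel (?Q k)" if "k \<in> G" for k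
    proof -
      have "0 < snd k" using that G(1) F(2) by auto
      then show ?thesis
        by (simp add: emeasure_cube power_mult_distrib ennreal_mult ennreal_power[symmetric])
    qed
    then show ?thesis by simp
  qed
  also have "\<dots> = 3 ^ CARD('d) * (\<Sum>k\<in>G. t * emeasure lborel (?Q k))"
    by (simp add: sum_distrib_left mult_ac)
  also have "\<dots> \<le> 3 ^ CARD('d) * (\<Sum>k\<in>G. emeasure (density lborel g) (?Q k))"
    using t G(1) by (intro mult_left_mono sum_mono) (auto simp: emeasure_density)
  also have "\<dots> \<le> 3 ^ CARD('d) * (\<integral>\<^sup>+ w. g w \<partial>lborel)"
  proof (rule mult_left_mono)
    have "(\<Sum>k\<in>G. emeasure (density lborel g) (?Q k)) = emeasure (density lborel g) (\<Union>k\<in>G. ?Q k)"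
      using fin G(2) by (intro sum_emeasure) auto
    also have "\<dots> \<le> emeasure (density lborel g) UNIV"
      by (rule emeasure_mono) auto
    also have "\<dots> = (\<integral>\<^sup>+ w. g w \<partial>lborel)"
      by (simp add: emeasure_density)
    finally show "(\<Sum>k\<in>G. emeasure (density lborel g) (?Q k)) \<le> (\<integral>\<^sup>+ w. g w \<partial>lborel)" .
  qed simp
  finally show ?thesis .
qed

text \<open>The level set is the union of the countably many cubes of \<open>K\<close> with large
  average; finite subunions exhaust it and obey the bound with the same constant.\<close>

lemma cube_maximal_weak_type:
  fixes g :: "real ^ 'd \<Rightarrow> ennreal"
  assumes g[measurable]: "g \<in> borel_measurable borel"
  shows "t * emeasure lborel {x. t < cube_maximal g x} \<le> 3 ^ CARD('d) * (\<integral>\<^sup>+ w. g w \<partial>lborel)"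
proof -
  let ?Q = "\<lambda>k. cube (fst k) (snd k) :: (real ^ 'd) set"
  obtain K :: "((real ^ 'd) \<times> real) set" where K': "countable K \<and> K \<subseteq> UNIV \<times> {0<..} \<and>
    (\<forall>g t x. t < cube_maximal g x \<longleftrightarrow>
      (\<exists>(c, r) \<in> K. x \<in> cube c r \<and> t * emeasure lborel (cube c r) < (\<integral>\<^sup>+ w \<in> cube c r. g w \<partial>lborel)))"
    using countable_cubes by (rule exE)
  note K = conjunct1[OF K'] conjunct1[OF conjunct2[OF K']] conjunct2[OF conjunct2[OF K'], rule_format]
  define L where "L = {k \<in> K. t * emeasure lborel (?Q k) < (\<integral>\<^sup>+ w \<in> ?Q k. g w \<partial>lborel)}"
  have eq: "{x. t < cube_maximal g x} = (\<Union>k\<in>L. ?Q k)"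
    unfolding K(3) L_def by auto
  have L: "countable L" "L \<subseteq> UNIV \<times> {0<..}"
    using K(1,2) countable_subset[of L K] by (auto simp: L_def)
  show ?thesis
  proof (cases "L = {}")
    case True
    then show ?thesis unfolding eq by simp
  next
    case False
    define A where "A n = (\<Union>i\<le>n. ?Q (from_nat_into L i))" for n :: nat
    have A: "range A \<subseteq> sets lborel" unfolding A_def by auto
    have A': "incseq A" unfolding A_def by (rule monoI, rule UN_mono) auto
    have "(\<Union>k\<in>L. ?Q k) = (\<Union>n. A n)"
    proof -
      have "(\<Union>k\<in>range (from_nat_into L). ?Q k) = (\<Union>n. A n)"
        unfolding A_def by blast
      then show ?thesis by (simp only: range_from_nat_into[OF False L(1)])
    qed
    then have "t * emeasure lborel (\<Union>k\<in>L. ?Q k) = (SUP n. t * emeasure lborel (A n))"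
      using SUP_emeasure_incseq[OF A A'] by (simp add: SUP_mult_left_ennreal[symmetric])
    also have "\<dots> \<le> 3 ^ CARD('d) * (\<integral>\<^sup>+ w. g w \<partial>lborel)"
    proof (rule SUP_least)
      fix n
      have "A n = (\<Union>k\<in>from_nat_into L ` {..n}. ?Q k)" by (simp add: A_def)
      moreover have sub: "from_nat_into L ` {..n} \<subseteq> L" using from_nat_into[OF False] by auto
      then have "t * emeasure lborel (\<Union>k\<in>from_nat_into L ` {..n}. ?Q k) \<le> 3 ^ CARD('d) * (\<integral>\<^sup>+ w. g w \<partial>lborel)"
      proof (intro weak_type_finite g)
        show "from_nat_into L ` {..n} \<subseteq> UNIV \<times> {0<..}" using sub L(2) by (rule order_trans)
        fix k assume "k \<in> from_nat_into L ` {..n}"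
        then have "k \<in> L" using sub by (rule rev_subsetD)
        then show "t * emeasure lborel (?Q k) \<le> (\<integral>\<^sup>+ w \<in> ?Q k. g w \<partial>lborel)"
          unfolding L_def by (intro less_imp_le) simp
      qed simp
      ultimately show "t * emeasure lborel (A n) \<le> 3 ^ CARD('d) * (\<integral>\<^sup>+ w. g w \<partial>lborel)" by simp
    qed
    finally show ?thesis unfolding eq .
  qed
qed

text \<open>Values of \<open>g\<close> up to \<open>t\<close> contribute at most \<open>t\<close> to
  any average, so an average above \<open>2 * t\<close> leaves more than \<open>t\<close> for the
  part \<open>h\<close> above the threshold. Only the tail of \<open>g\<close> then appears on the
  right, which is what interpolation needs.\<close>

lemma cube_maximal_weak_type_truncated:
  fixes g :: "real ^ 'd \<Rightarrow> ennreal"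
  assumes [measurable]: "g \<in> borel_measurable borel" and t: "0 \<le> t"
  shows "ennreal t * emeasure lborel {x. ennreal (2 * t) < cube_maximal g x} \<le>
    3 ^ CARD('d) * (\<integral>\<^sup>+ w. g w * indicator {w. ennreal t < g w} w \<partial>lborel)"
proof -
  define h where "h w = g w * indicator {w. ennreal t < g w} w" for w
  have [measurable]: "h \<in> borel_measurable borel" unfolding h_def by measurable
  have "{x. ennreal (2 * t) < cube_maximal g x} \<subseteq> {x. ennreal t < cube_maximal h x}"
  proof
    fix x assume "x \<in> {x. ennreal (2 * t) < cube_maximal g x}"
    then obtain c r where cr: "0 < r" "x \<in> cube c r"
      "ennreal (2 * t) * emeasure lborel (cube c r) < (\<integral>\<^sup>+ w \<in> cube c r. g w \<partial>lborel)"
      unfolding mem_Collect_eq less_cube_maximal_iff by blast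
    have "(\<integral>\<^sup>+ w \<in> cube c r. g w \<partial>lborel)
        \<le> (\<integral>\<^sup>+ w. ennreal t * indicator (cube c r) w + h w * indicator (cube c r) w \<partial>lborel)"
      by (intro nn_integral_mono) (auto simp: h_def indicator_def)
    also have "\<dots> = ennreal t * emeasure lborel (cube c r) + (\<integral>\<^sup>+ w \<in> cube c r. h w \<partial>lborel)"
      by (subst nn_integral_add) (auto simp: nn_integral_cmult_indicator)
    finally have le: "(\<integral>\<^sup>+ w \<in> cube c r. g w \<partial>lborel) \<le>
        ennreal t * emeasure lborel (cube c r) + (\<integral>\<^sup>+ w \<in> cube c r. h w \<partial>lborel)" .
    have "ennreal (2 * t) = ennreal t + ennreal t"
      using t by (simp add: ennreal_plus[symmetric] del: ennreal_plus)
    then have "ennreal t * emeasure lborel (cube c r) + ennreal t * emeasure lborel (cube c r)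
        = ennreal (2 * t) * emeasure lborel (cube c r)" by (simp only: distrib_right)
    also note cr(3)
    also note le
    finally have "ennreal t * emeasure lborel (cube c r) + ennreal t * emeasure lborel (cube c r) <
        ennreal t * emeasure lborel (cube c r) + (\<integral>\<^sup>+ w \<in> cube c r. h w \<partial>lborel)" .
    then have "ennreal t * emeasure lborel (cube c r) < (\<integral>\<^sup>+ w \<in> cube c r. h w \<partial>lborel)"
      by (meson add_left_mono not_le)
    then show "x \<in> {x. ennreal t < cube_maximal h x}"
      unfolding mem_Collect_eq less_cube_maximal_iff using cr(1,2) by (intro exI conjI)
  qed
  then have "emeasure lborel {x. ennreal (2 * t) < cube_maximal g x} \<le> emeasure lborel {x. ennreal t < cube_maximal h x}"
    by (rule emeasure_mono) measurable
  then have "ennreal t * emeasure lborel {x. ennreal (2 * t) < cube_maximal g x} \<le>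
      ennreal t * emeasure lborel {x. ennreal t < cube_maximal h x}"
    by (rule mult_left_mono) simp
  also have "\<dots> \<le> 3 ^ CARD('d) * (\<integral>\<^sup>+ w. h w \<partial>lborel)"
    by (rule cube_maximal_weak_type) measurable
  finally show ?thesis by (simp only: h_def)
qed

text \<open>An inequality because the index 0 is counted in both sums. It reduces finiteness of a
  two-sided sum to two one-sided ones.\<close>

lemma nn_integral_int_le:
  fixes F :: "int \<Rightarrow> ennreal"
  shows "(\<integral>\<^sup>+ k. F k \<partial>count_space UNIV) \<le> (\<Sum>n. F (int n)) + (\<Sum>n. F (- int n))"
proof -
  have 1: "(\<Sum>n. F (int n)) = (\<integral>\<^sup>+ k. F k * indicator {0..} k \<partial>count_space UNIV)"
  proof -
    have "bij_betw int UNIV {0..}"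
      by (rule bij_betwI[where g = nat]) auto
    from nn_integral_bij_count_space[OF this, of F] show ?thesis
      by (simp add: nn_integral_count_space_nat nn_integral_count_space_indicator)
  qed
  have 2: "(\<Sum>n. F (- int n)) = (\<integral>\<^sup>+ k. F k * indicator {..0} k \<partial>count_space UNIV)"
  proof -
    have "bij_betw (\<lambda>n. - int n) UNIV {..0}"
      by (rule bij_betwI[where g = "\<lambda>k. nat (- k)"]) auto
    from nn_integral_bij_count_space[OF this, of F] show ?thesis
      by (simp add: nn_integral_count_space_nat nn_integral_count_space_indicator)
  qed
  have "(\<integral>\<^sup>+ k. F k \<partial>count_space UNIV) \<le>
      (\<integral>\<^sup>+ k. F k * indicator {0..} k + F k * indicator {..0} k \<partial>count_space UNIV)"
    by (intro nn_integral_mono) (auto simp: indicator_def)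
  also have "\<dots> = (\<Sum>n. F (int n)) + (\<Sum>n. F (- int n))"
    unfolding 1 2 by (rule nn_integral_add) auto
  finally show ?thesis .
qed

section \<open>Sums over dyadic levels and interpolation to L^p\<close>

lemma suminf_ennreal_powr_geometric:
  assumes "0 < c"
  shows "(\<Sum>n. ennreal (2 powr (- c * real n))) = ennreal (1 / (1 - 2 powr (- c)))"
proof (rule suminf_ennreal_eq)
  have "2 powr (- c) < (1::real)" using assms by (simp add: powr_less_one)
  then have "(\<lambda>n. (2 powr (- c)) ^ n) sums (1 / (1 - 2 powr (- c)))" by (intro geometric_sums) simp
  then show "(\<lambda>n. 2 powr (- c * real n)) sums (1 / (1 - 2 powr (- c)))"
    by (simp add: powr_realpow[symmetric] powr_powr)
qed simp

lemma borel_measurable_nn_integral_countable: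
  fixes f :: "'i \<Rightarrow> 'a \<Rightarrow> ennreal"
  assumes "countable I" and [measurable]: "\<And>i. i \<in> I \<Longrightarrow> f i \<in> borel_measurable M"
  shows "(\<lambda>x. \<integral>\<^sup>+ i. f i x \<partial>count_space I) \<in> borel_measurable M"
proof (cases "finite I")
  case True
  then show ?thesis by (simp add: nn_integral_count_space_finite)
next
  case False
  then have bij: "bij_betw (from_nat_into I) UNIV I"
    using assms(1) by (rule bij_betw_from_nat_into[rotated])
  have "from_nat_into I n \<in> I" for n using bij by (auto simp: bij_betw_def)
  then show ?thesis
    by (simp add: nn_integral_bij_count_space[OF bij, symmetric] nn_integral_count_space_nat)
qed

text \<open>Upper half of a dyadic layer-cake formula: the levels below \<open>y\<close> are those
  up to about log 2 y, and a geometric sum is dominated by its largest term. Applied with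
  \<open>a\<close> = p - 1.\<close>

lemma level_sum_le:
  assumes a: "0 < a" and y: "0 \<le> y"
  shows "(\<integral>\<^sup>+ k. ennreal (2 powr (real_of_int k * a)) * indicator {k. 2 powr real_of_int k < y} k \<partial>count_space UNIV)
    \<le> ennreal (1 / (1 - 2 powr (- a)) * y powr a)"
proof (cases "y = 0")
  case True
  then have "{k::int. 2 powr real_of_int k < y} = {}"
    by (auto simp: not_less)
  then show ?thesis by simp
next
  case False
  define K where "K = \<lfloor>log 2 y\<rfloor>"
  have bij: "bij_betw (\<lambda>n. K - int n) UNIV {..K}"
    by (rule bij_betwI[where g = "\<lambda>k. nat (K - k)"]) auto
  have sub: "{k::int. 2 powr real_of_int k < y} \<subseteq> {..K}"
    using False y by (auto simp: K_def le_floor_iff less_log_iff[symmetric] intro: less_imp_le)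
  have "(\<integral>\<^sup>+ k. ennreal (2 powr (real_of_int k * a)) * indicator {k. 2 powr real_of_int k < y} k \<partial>count_space UNIV)
      \<le> (\<integral>\<^sup>+ k. ennreal (2 powr (real_of_int k * a)) * indicator {..K} k \<partial>count_space UNIV)"
    using sub by (intro nn_integral_mono mult_left_mono) (auto simp: indicator_def)
  also have "\<dots> = (\<integral>\<^sup>+ k. ennreal (2 powr (real_of_int k * a)) \<partial>count_space {..K})"
    by (simp add: nn_integral_count_space_indicator)
  also have "\<dots> = (\<Sum>n. ennreal (2 powr (real_of_int (K - int n) * a)))"
    by (simp add: nn_integral_bij_count_space[OF bij, symmetric] nn_integral_count_space_nat)
  also have "\<dots> = (\<Sum>n. ennreal (2 powr (real_of_int K * a)) * ennreal (2 powr (- a * real n)))"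
    by (simp add: ennreal_mult[symmetric] powr_add[symmetric] algebra_simps)
  also have "\<dots> = ennreal (2 powr (real_of_int K * a)) * ennreal (1 / (1 - 2 powr (- a)))"
    by (simp only: ennreal_suminf_cmult suminf_ennreal_powr_geometric[OF a])
  also have "\<dots> \<le> ennreal (y powr a) * ennreal (1 / (1 - 2 powr (- a)))"
  proof (intro mult_right_mono ennreal_leI)
    have "2 powr real_of_int K \<le> y"
      using False y by (simp add: K_def le_log_iff[symmetric])
    then have "(2 powr real_of_int K) powr a \<le> y powr a" using a by (intro powr_mono2) auto
    then show "2 powr (real_of_int K * a) \<le> y powr a" by (simp add: powr_powr)
  qed simp
  also have "\<dots> = ennreal (1 / (1 - 2 powr (- a)) * y powr a)"
    using a by (subst ennreal_mult[symmetric]) (auto simp: mult.commute intro!: powr_less_one less_imp_le)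
  finally show ?thesis .
qed

text \<open>Lower half of the dyadic layer-cake formula: one suitable level already carries the size
  of \<open>x\<close>. The factor 2 in the threshold matches the truncated weak type
  estimate.\<close>

lemma level_sum_ge:
  assumes p: "1 \<le> p"
  shows "epowr x p \<le> ennreal (4 powr p) * (\<integral>\<^sup>+ k. ennreal (2 powr (real_of_int k * p)) *
    indicator {k. ennreal (2 * 2 powr real_of_int k) < x} k \<partial>count_space UNIV)" (is "_ \<le> _ * ?S")
proof (cases x)
  case (real y)
  show ?thesis
  proof (cases "y = 0")
    case True
    then show ?thesis using real by simp
  next
    case False
    \<comment> \<open>The offset 2 gives 2 * 2^k < y \<le> 4 * 2^k: the first inequality puts
      \<open>k\<close> among the levels, the second costs \<open>4 powr p\<close>.\<close>
    define k where "k = \<lceil>log 2 y\<rceil> - 2"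
    have up: "y \<le> 2 powr real_of_int (k + 2)"
      using False real by (simp add: k_def log_le_iff[symmetric])
    have lo: "2 powr real_of_int (k + 1) < y"
    proof -
      have "real_of_int (k + 1) < log 2 y" unfolding k_def by linarith
      then show ?thesis using False real by (simp add: less_log_iff)
    qed
    have "epowr x p = ennreal (y powr p)" using real by (simp add: epowr_ennreal)
    also have "\<dots> \<le> ennreal (4 powr p * 2 powr (real_of_int k * p))"
    proof (rule ennreal_leI)
      have "y powr p \<le> (2 powr real_of_int (k + 2)) powr p"
        using p real up by (intro powr_mono2) auto
      also have "\<dots> = 2 powr (2 * p) * 2 powr (real_of_int k * p)"
        by (simp add: powr_powr powr_add[symmetric] algebra_simps)
      also have "2 powr (2 * p) = (2 powr 2) powr p" by (simp only: powr_powr)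
      also have "(2::real) powr 2 = 4" by simp
      finally show "y powr p \<le> 4 powr p * 2 powr (real_of_int k * p)" .
    qed
    also have "\<dots> = ennreal (4 powr p) * (ennreal (2 powr (real_of_int k * p)) *
        indicator {k. ennreal (2 * 2 powr real_of_int k) < x} k)"
    proof -
      have "2 * 2 powr real_of_int k < y" using lo by (simp add: powr_add mult.commute)
      then have "k \<in> {k. ennreal (2 * 2 powr real_of_int k) < x}"
        using real by (simp add: ennreal_less_iff)
      then show ?thesis by (simp only: indicator_simps ennreal_mult powr_ge_zero mult_1_right)
    qed
    also have "\<dots> \<le> ennreal (4 powr p) * ?S"
      by (intro mult_left_mono nn_integral_ge_point) auto
    finally show ?thesis .
  qed
next
  case top
  \<comment> \<open>All levels are present, and the single terms with \<open>k\<close> = n alone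
    exceed every bound.\<close>
  have "?S = top"
  proof (rule ccontr)
    assume "?S \<noteq> top"
    then obtain B where B: "?S = ennreal B" "0 \<le> B" by (cases ?S) auto
    obtain n :: nat where n: "B < real n" using reals_Archimedean2 by blast
    have "real n \<le> 2 ^ n" by (simp add: less_imp_le)
    also have "\<dots> = 2 powr real n" by (simp add: powr_realpow)
    also have "\<dots> \<le> 2 powr (real n * p)" using p by (intro powr_mono) (auto simp: mult_le_cancel_left1)
    finally have "B < 2 powr (real_of_int (int n) * p)" using n by simp
    then have "?S < ennreal (2 powr (real_of_int (int n) * p)) *
        indicator {k. ennreal (2 * 2 powr real_of_int k) < x} (int n)"
      using top B by (simp add: ennreal_less_iff)
    also have "\<dots> \<le> ?S" by (rule nn_integral_ge_point) simp
    finally show False by simp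
  qed
  then show ?thesis by (simp add: ennreal_mult_top)
qed

text \<open>Marcinkiewicz interpolation between weak type (1,1) and L^\<infinity> on dyadic levels:
  after summing the truncated weak type bounds and exchanging sum and integral, each point w carries
  g w times the sum of 2^(k (p - 1)) over the levels below g w, which is at most a constant times (g
  w)^p.\<close>

theorem cube_maximal_strong_type:
  assumes p: "1 < p"
  shows "\<exists>C>0. \<forall>g :: real ^ 'd \<Rightarrow> ennreal. g \<in> borel_measurable borel \<longrightarrow>
    (\<integral>\<^sup>+ x. epowr (cube_maximal g x) p \<partial>lborel) \<le> ennreal C * (\<integral>\<^sup>+ x. epowr (g x) p \<partial>lborel)"
proof -
  \<comment> \<open>The constant of \<open>level_sum_le\<close> for exponent p - 1; the geometric
    series converges because p > 1.\<close>
  define C0 where "C0 = 1 / (1 - 2 powr (- (p - 1)))"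
  have C0: "0 < C0" using p by (simp add: C0_def powr_less_one)
  define C where "C = 4 powr p * 3 ^ CARD('d) * C0"
  have "0 < C" using C0 by (simp add: C_def)
  moreover have "(\<integral>\<^sup>+ x. epowr (cube_maximal g x) p \<partial>lborel) \<le> ennreal C * (\<integral>\<^sup>+ x. epowr (g x) p \<partial>lborel)"
    if [measurable]: "g \<in> borel_measurable borel" for g :: "real ^ 'd \<Rightarrow> ennreal"
  proof -
    let ?A = "\<lambda>k::int. {x. ennreal (2 * 2 powr real_of_int k) < cube_maximal g x}"
    let ?B = "\<lambda>k::int. {x. ennreal (2 powr real_of_int k) < g x}"
    have "(\<integral>\<^sup>+ x. epowr (cube_maximal g x) p \<partial>lborel) \<le>
       (\<integral>\<^sup>+ x. ennreal (4 powr p) * (\<integral>\<^sup>+ k. ennreal (2 powr (real_of_int k * p)) * indicator (?A k) x \<partial>count_space UNIV) \<partial>lborel)"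
    proof (rule nn_integral_mono)
      fix x
      show "epowr (cube_maximal g x) p \<le>
          ennreal (4 powr p) * (\<integral>\<^sup>+ k. ennreal (2 powr (real_of_int k * p)) * indicator (?A k) x \<partial>count_space UNIV)"
        using level_sum_ge[of p "cube_maximal g x"] p by (simp add: indicator_def)
    qed
    also have "\<dots> = ennreal (4 powr p) * (\<integral>\<^sup>+ x. \<integral>\<^sup>+ k. ennreal (2 powr (real_of_int k * p)) * indicator (?A k) x \<partial>count_space UNIV \<partial>lborel)"
      by (intro nn_integral_cmult borel_measurable_nn_integral_countable) auto
    also have "(\<integral>\<^sup>+ x. \<integral>\<^sup>+ k. ennreal (2 powr (real_of_int k * p)) * indicator (?A k) x \<partial>count_space UNIV \<partial>lborel)
        = (\<integral>\<^sup>+ k. \<integral>\<^sup>+ x. ennreal (2 powr (real_of_int k * p)) * indicator (?A k) x \<partial>lborel \<partial>count_space UNIV)"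
      by (rule nn_integral_count_space_nn_integral) auto
    also have "\<dots> = (\<integral>\<^sup>+ k. ennreal (2 powr (real_of_int k * (p - 1))) * (ennreal (2 powr real_of_int k) * emeasure lborel (?A k)) \<partial>count_space UNIV)"
    proof (rule nn_integral_cong)
      fix k
      \<comment> \<open>One factor 2^k is split off for the weak type estimate at level 2^k.\<close>
      have eq: "ennreal (2 powr (real_of_int k * p)) = ennreal (2 powr (real_of_int k * (p - 1))) * ennreal (2 powr real_of_int k)"
        by (simp add: ennreal_mult[symmetric] powr_add[symmetric] algebra_simps)
      have "(\<integral>\<^sup>+ x. ennreal (2 powr (real_of_int k * p)) * indicator (?A k) x \<partial>lborel) =
          ennreal (2 powr (real_of_int k * p)) * emeasure lborel (?A k)"
        by (rule nn_integral_cmult_indicator) measurable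
      then show "(\<integral>\<^sup>+ x. ennreal (2 powr (real_of_int k * p)) * indicator (?A k) x \<partial>lborel) =
         ennreal (2 powr (real_of_int k * (p - 1))) * (ennreal (2 powr real_of_int k) * emeasure lborel (?A k))"
        by (simp only: eq mult.assoc)
    qed
    also have "ennreal (4 powr p) * \<dots> \<le> ennreal (4 powr p) * (\<integral>\<^sup>+ k. ennreal (2 powr (real_of_int k * (p - 1))) *
       (3 ^ CARD('d) * (\<integral>\<^sup>+ w. g w * indicator (?B k) w \<partial>lborel)) \<partial>count_space UNIV)"
      by (intro mult_left_mono nn_integral_mono cube_maximal_weak_type_truncated) auto
    also have "\<dots> = ennreal (4 powr p) * (\<integral>\<^sup>+ k. \<integral>\<^sup>+ w. 3 ^ CARD('d) * g w *
       (ennreal (2 powr (real_of_int k * (p - 1))) * indicator (?B k) w) \<partial>lborel \<partial>count_space UNIV)"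
      by (simp add: nn_integral_cmult[symmetric] mult_ac)
    also have "\<dots> = ennreal (4 powr p) * (\<integral>\<^sup>+ w. \<integral>\<^sup>+ k. 3 ^ CARD('d) * g w *
       (ennreal (2 powr (real_of_int k * (p - 1))) * indicator (?B k) w) \<partial>count_space UNIV \<partial>lborel)"
      by (subst nn_integral_count_space_nn_integral) auto
    also have "\<dots> = ennreal (4 powr p) * (\<integral>\<^sup>+ w. 3 ^ CARD('d) * (g w * (\<integral>\<^sup>+ k.
       (ennreal (2 powr (real_of_int k * (p - 1))) * indicator (?B k) w) \<partial>count_space UNIV)) \<partial>lborel)"
      by (simp add: nn_integral_cmult mult.assoc)
    also have "\<dots> \<le> ennreal (4 powr p) * (\<integral>\<^sup>+ w. 3 ^ CARD('d) * (ennreal C0 * epowr (g w) p) \<partial>lborel)"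
    proof (intro mult_left_mono nn_integral_mono)
      fix w
      show "g w * (\<integral>\<^sup>+ k. (ennreal (2 powr (real_of_int k * (p - 1))) * indicator (?B k) w) \<partial>count_space UNIV)
         \<le> ennreal C0 * epowr (g w) p"
      proof (cases "g w")
        case (real y)
        have "(\<integral>\<^sup>+ k. (ennreal (2 powr (real_of_int k * (p - 1))) * indicator (?B k) w) \<partial>count_space UNIV)
           = (\<integral>\<^sup>+ k. ennreal (2 powr (real_of_int k * (p - 1))) * indicator {k. 2 powr real_of_int k < y} k \<partial>count_space UNIV)"
          using real by (intro nn_integral_cong) (auto simp: indicator_def ennreal_less_iff)
        also have "\<dots> \<le> ennreal (C0 * y powr (p - 1))"
          unfolding C0_def using p real by (intro level_sum_le) auto
        finally have "g w * (\<integral>\<^sup>+ k. (ennreal (2 powr (real_of_int k * (p - 1))) * indicator (?B k) w) \<partial>count_space UNIV)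
           \<le> ennreal y * ennreal (C0 * y powr (p - 1))"
          by (intro mult_mono) (simp_all add: real)
        also have "\<dots> = ennreal (C0 * (y * y powr (p - 1)))"
          using real C0 by (simp add: ennreal_mult[symmetric] mult_ac)
        also have "y * y powr (p - 1) = y powr p"
          using real by (cases "y = 0") (auto simp: powr_diff)
        finally show ?thesis using real C0 by (simp add: epowr_ennreal ennreal_mult)
      next
        case top
        then show ?thesis using C0 by (simp add: ennreal_mult_top)
      qed
    qed auto
    also have "\<dots> = ennreal C * (\<integral>\<^sup>+ x. epowr (g x) p \<partial>lborel)"
    proof -
      have "ennreal C = ennreal (4 powr p) * (3 ^ CARD('d) * ennreal C0)"
        using C0 by (simp add: C_def ennreal_mult ennreal_power[symmetric] mult.assoc)
      moreover have "(\<integral>\<^sup>+ w. 3 ^ CARD('d) * (ennreal C0 * epowr (g w) p) \<partial>lborel) =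
          3 ^ CARD('d) * ennreal C0 * (\<integral>\<^sup>+ w. epowr (g w) p \<partial>lborel)"
        by (simp add: nn_integral_cmult[symmetric] mult.assoc)
      ultimately show ?thesis by (simp only: mult.assoc)
    qed
    finally show ?thesis .
  qed
  ultimately show ?thesis by blast
qed

section \<open>Functions living on one dyadic shell\<close>

lemma dyadic_power: "2 powi k = 2 powr real_of_int k" for k :: int
  by (simp add: powr_real_of_int')

lemma mem_dyadic_cube: "x \<in> dyadic_cube k \<longleftrightarrow> (\<forall>i. \<bar>x $ i\<bar> \<le> 2 powr real_of_int k / 2)"
  by (simp add: dyadic_cube_def mem_cube dyadic_power)

lemma dyadic_cube_measurable [measurable]: "dyadic_cube k \<in> sets borel"
  by (simp add: dyadic_cube_def)

lemma dyadic_shell_measurable [measurable]: "dyadic_shell k \<in> sets borel"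
  by (simp add: dyadic_shell_def)

text \<open>In terms of the sup norm, shell \<open>k\<close> is the annulus from 2^(k - 2),
  excluded, to 2^(k - 1), included: a cube of side 2^k has half side 2^(k - 1).\<close>

lemma mem_dyadic_shell:
  "x \<in> dyadic_shell k \<longleftrightarrow>
    (\<forall>i. \<bar>x $ i\<bar> \<le> 2 powr real_of_int k / 2) \<and> (\<exists>i. 2 powr (real_of_int k - 1) / 2 < \<bar>x $ i\<bar>)"
  by (auto simp: dyadic_shell_def mem_dyadic_cube not_le)

lemma emeasure_dyadic_cube:
  "emeasure lborel (dyadic_cube k :: (real ^ 'd) set) = ennreal (2 powr (real_of_int k * real CARD('d)))"
  by (simp add: dyadic_cube_def emeasure_cube dyadic_power powr_realpow[symmetric] powr_powr)

lemma emeasure_dyadic_shell_le: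
  "emeasure lborel (dyadic_shell k :: (real ^ 'd) set) \<le> ennreal (2 powr (real_of_int k * real CARD('d)))"
  unfolding emeasure_dyadic_cube[symmetric] by (rule emeasure_mono) (auto simp: dyadic_shell_def)

text \<open>Some coordinate of \<open>x\<close> exceeds 2^(k - 2) in modulus while those of
  \<open>u\<close> are at most 2^(k - 3), so the points differ there by more than 2^(k - 3). The gap
  of two matters: neighbouring shells touch.\<close>

lemma side_length_ge_of_far_shells:
  fixes x u c :: "real ^ 'd"
  assumes x: "x \<in> dyadic_shell k" "x \<in> cube c r" and u: "u \<in> dyadic_shell i" "u \<in> cube c r"
    and far: "i + 2 \<le> k"
  shows "2 powr (real_of_int k - 3) \<le> r"
proof -
  obtain j where j: "2 powr (real_of_int k - 1) / 2 < \<bar>x $ j\<bar>"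
    using x(1) by (auto simp: mem_dyadic_shell)
  have "\<bar>u $ j\<bar> \<le> 2 powr real_of_int i / 2" using u(1) by (auto simp: mem_dyadic_shell)
  also have "\<dots> \<le> 2 powr (real_of_int k - 2) / 2" using far by (intro divide_right_mono powr_mono) auto
  finally have *: "\<bar>u $ j\<bar> \<le> 2 powr (real_of_int k - 2) / 2" .
  have **: "\<bar>x $ j - c $ j\<bar> \<le> r / 2" "\<bar>u $ j - c $ j\<bar> \<le> r / 2"
    using x(2) u(2) by (auto simp: mem_cube)
  define P where "P = 2 powr (real_of_int k - 3)"
  have "2 powr (real_of_int k - 1) = 4 * P" "2 powr (real_of_int k - 2) = 2 * P"
    by (simp_all add: P_def powr_diff)
  then show ?thesis using j * ** unfolding P_def[symmetric] by linarith
qed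

text \<open>A cube through \<open>x\<close> either misses the support of \<open>g\<close>, with
  average 0, or meets both shells; its volume is then at least that of side 2^(max k i - 3).\<close>

lemma cube_maximal_le_of_far_shell:
  fixes g :: "real ^ 'd \<Rightarrow> ennreal"
  assumes x: "x \<in> dyadic_shell k" and g: "\<And>u. u \<notin> dyadic_shell i \<Longrightarrow> g u = 0"
    and far: "i + 2 \<le> k \<or> k + 2 \<le> i"
  shows "cube_maximal g x \<le>
    ennreal (2 powr ((3 - real_of_int (max k i)) * real CARD('d))) * (\<integral>\<^sup>+ w. g w \<partial>lborel)"
  unfolding cube_maximal_def
proof (rule SUP_least, clarify)
  fix c :: "real ^ 'd" and r :: real
  assume r: "0 < r" and xc: "x \<in> cube c r"
  let ?m = "2 powr ((real_of_int (max k i) - 3) * real CARD('d))"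
  show "(\<integral>\<^sup>+ w \<in> cube c r. g w \<partial>lborel) / emeasure lborel (cube c r) \<le>
      ennreal (2 powr ((3 - real_of_int (max k i)) * real CARD('d))) * (\<integral>\<^sup>+ w. g w \<partial>lborel)"
  proof (cases "\<exists>u \<in> dyadic_shell i. u \<in> cube c r")
    case False
    then have "(\<integral>\<^sup>+ w \<in> cube c r. g w \<partial>lborel) = (\<integral>\<^sup>+ w. 0 \<partial>(lborel :: (real ^ 'd) measure))"
      using g by (intro nn_integral_cong) (auto simp: indicator_def)
    then show ?thesis by simp
  next
    case True
    then obtain u where u: "u \<in> dyadic_shell i" "u \<in> cube c r" by blast
    have "2 powr (real_of_int (max k i) - 3) \<le> r"
      using far
    proof
      assume "i + 2 \<le> k"
      then show ?thesis using side_length_ge_of_far_shells[OF x xc u] by (simp add: max_def)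
    next
      assume "k + 2 \<le> i"
      then show ?thesis using side_length_ge_of_far_shells[OF u x xc] by (simp add: max_def)
    qed
    then have "(2 powr (real_of_int (max k i) - 3)) ^ CARD('d) \<le> r ^ CARD('d)"
      by (intro power_mono) auto
    then have m: "?m \<le> r ^ CARD('d)" by (simp add: powr_realpow[symmetric] powr_powr)
    have "(\<integral>\<^sup>+ w \<in> cube c r. g w \<partial>lborel) \<le> (\<integral>\<^sup>+ w. g w \<partial>lborel)"
      by (intro nn_integral_mono) (simp add: indicator_def)
    also have "\<dots> = ennreal ?m * (ennreal (2 powr ((3 - real_of_int (max k i)) * real CARD('d))) * (\<integral>\<^sup>+ w. g w \<partial>lborel))"
    proof -
      have "ennreal ?m * ennreal (2 powr ((3 - real_of_int (max k i)) * real CARD('d))) = 1"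
        by (simp add: ennreal_mult[symmetric] powr_add[symmetric] distrib_right[symmetric])
      then show ?thesis by (simp only: mult.assoc[symmetric] mult_1_left)
    qed
    also have "\<dots> \<le> emeasure lborel (cube c r) *
        (ennreal (2 powr ((3 - real_of_int (max k i)) * real CARD('d))) * (\<integral>\<^sup>+ w. g w \<partial>lborel))"
      using m r by (intro mult_right_mono) (auto simp: emeasure_cube)
    finally show ?thesis by (rule divide_le_posI_ennreal[OF emeasure_cube_pos(1)[OF r]])
  qed
qed

text \<open>Above \<open>t\<close>, y = y^(1 - p) y^p \<le> t^(1 - p) y^p. This pointwise bound
  passes from L^p to L^1 on sets of finite measure.\<close>

lemma ennreal_le_add_epowr:
  assumes t: "0 < t" and p: "1 \<le> p"
  shows "y \<le> ennreal t + ennreal (t powr (1 - p)) * epowr y p"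
proof (cases y)
  case (real r)
  show ?thesis
  proof (cases "r \<le> t")
    case True
    then show ?thesis using real by (simp add: add_increasing2)
  next
    case False
    then have "r powr (1 - p) \<le> t powr (1 - p)" using t p by (intro powr_mono2') auto
    then have "r powr (1 - p) * r powr p \<le> t powr (1 - p) * r powr p" by (rule mult_right_mono) simp
    then have "r \<le> t powr (1 - p) * r powr p" using False t by (simp add: powr_add[symmetric])
    then have "ennreal r \<le> ennreal (t powr (1 - p)) * epowr y p"
      using real by (simp add: epowr_ennreal ennreal_mult[symmetric])
    then show ?thesis using real by (simp add: add_increasing)
  qed
next
  case top
  then show ?thesis using t by (simp add: ennreal_mult_top)
qed

section \<open>Hoelder's inequality and the shell estimate in one variable\<close>

lemma epowr_eq_0_iff: "epowr x a = 0 \<longleftrightarrow> x = 0"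
  by (cases x) (auto simp: epowr_ennreal)

text \<open>Integrating y \<le> t + t^(1 - p) y^p over the support and optimising \<open>t\<close>
  gives Hoelder's inequality up to the factor \<open>2 powr p\<close>, which is harmless
  here.\<close>

lemma holder_on_finite_measure:
  assumes [measurable]: "g \<in> borel_measurable M" "S \<in> sets M"
    and g: "\<And>x. x \<in> space M \<Longrightarrow> x \<notin> S \<Longrightarrow> g x = 0"
    and v: "emeasure M S \<le> ennreal v" "0 < v" and p: "1 < p"
  shows "epowr (\<integral>\<^sup>+ x. g x \<partial>M) p \<le> ennreal (2 powr p * v powr (p - 1)) * (\<integral>\<^sup>+ x. epowr (g x) p \<partial>M)"
proof (cases "\<integral>\<^sup>+ x. epowr (g x) p \<partial>M")
  case top
  then show ?thesis using v by (simp add: ennreal_mult_top)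
next
  case (real I)
  show ?thesis
  proof (cases "I = 0")
    case True
    then have "AE x in M. epowr (g x) p = 0"
      using real by (subst nn_integral_0_iff_AE[symmetric]) auto
    then have "(\<integral>\<^sup>+ x. g x \<partial>M) = 0"
      by (subst nn_integral_0_iff_AE) (auto simp: epowr_eq_0_iff)
    then show ?thesis by simp
  next
    case False
    \<comment> \<open>This choice makes the two terms t * v and t^(1 - p) * I equal.\<close>
    define t where "t = (I / v) powr (1 / p)"
    have t: "0 < t" using False real v by (simp add: t_def)
    have I: "I = v * t powr p" using False real v p by (simp add: t_def powr_powr)
    have "(\<integral>\<^sup>+ x. g x \<partial>M) \<le> (\<integral>\<^sup>+ x. ennreal t * indicator S x + ennreal (t powr (1 - p)) * epowr (g x) p \<partial>M)"
      using ennreal_le_add_epowr[OF t, of p] p g by (intro nn_integral_mono) (auto simp: indicator_def)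
    also have "\<dots> = ennreal t * emeasure M S + ennreal (t powr (1 - p)) * (\<integral>\<^sup>+ x. epowr (g x) p \<partial>M)"
      by (simp add: nn_integral_add nn_integral_cmult nn_integral_cmult_indicator)
    also have "\<dots> \<le> ennreal t * ennreal v + ennreal (t powr (1 - p)) * ennreal I"
      using v real by (intro add_mono mult_left_mono) auto
    also have "\<dots> = ennreal (t * v + t powr (1 - p) * I)"
      using t v real by (simp add: ennreal_mult[symmetric] ennreal_plus[symmetric] del: ennreal_plus)
    also have "t * v + t powr (1 - p) * I = 2 * t * v"
    proof -
      have "t powr (1 - p) * I = v * (t powr (1 - p) * t powr p)" unfolding I by simp
      also have "t powr (1 - p) * t powr p = t" using t by (simp add: powr_add[symmetric])
      finally show ?thesis by simp
    qed
    finally have "epowr (\<integral>\<^sup>+ x. g x \<partial>M) p \<le> epowr (ennreal (2 * t * v)) p"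
      using p by (intro epowr_mono) auto
    also have "\<dots> = ennreal (2 powr p * v powr (p - 1) * I)"
      using t v unfolding I by (simp add: epowr_ennreal powr_mult powr_diff)
    also have "\<dots> = ennreal (2 powr p * v powr (p - 1)) * (\<integral>\<^sup>+ x. epowr (g x) p \<partial>M)"
      using real by (simp add: ennreal_mult)
    finally show ?thesis .
  qed
qed

text \<open>Up to a constant, the p-th power of the L^p norm of the maximal operator from shell i to
  shell i + e in dimension \<open>d\<close>. Outwards the averages are 2^(- k d) times the integral
  with k = i + e; inwards they are 2^(- i d) times it, and only the small volume of the target
  helps.\<close>

definition shell_decay :: "real \<Rightarrow> real \<Rightarrow> int \<Rightarrow> real" where
  "shell_decay d p e = (if 0 \<le> e then 2 powr (- real_of_int e * d * (p - 1)) else 2 powr (real_of_int e * d))"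

lemma shell_decay_pos: "0 < shell_decay d p e"
  by (simp add: shell_decay_def)

text \<open>The constant pointwise bound is raised to the power p and multiplied by the volume of
  shell \<open>k\<close>; Hoelder on shell \<open>i\<close> does the rest. In the constant, 3 d p
  comes from the side 2^(max k i - 3) and p from the Hoelder factor.\<close>

lemma cube_maximal_far_shell_estimate:
  fixes g :: "real ^ 'd \<Rightarrow> ennreal"
  assumes p: "1 < p" and [measurable]: "g \<in> borel_measurable borel"
    and g: "\<And>u. u \<notin> dyadic_shell i \<Longrightarrow> g u = 0" and far: "i + 2 \<le> k \<or> k + 2 \<le> i"
  shows "(\<integral>\<^sup>+ x \<in> dyadic_shell k. epowr (cube_maximal g x) p \<partial>lborel) \<le>
    ennreal (2 powr (3 * real CARD('d) * p + p) * shell_decay (real CARD('d)) p (k - i)) * (\<integral>\<^sup>+ x. epowr (g x) p \<partial>lborel)"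
proof -
  let ?d = "real CARD('d)" and ?m = "real_of_int (max k i)" and ?I = "\<integral>\<^sup>+ x. epowr (g x) p \<partial>lborel"
  let ?c = "2 powr ((3 - ?m) * ?d)"
  have hol: "epowr (\<integral>\<^sup>+ w. g w \<partial>lborel) p \<le> ennreal (2 powr p * (2 powr (real_of_int i * ?d)) powr (p - 1)) * ?I"
    by (rule holder_on_finite_measure[of _ _ "dyadic_shell i"])
      (use p g emeasure_dyadic_shell_le in auto)
  have "(\<integral>\<^sup>+ x \<in> dyadic_shell k. epowr (cube_maximal g x) p \<partial>lborel) \<le>
      (\<integral>\<^sup>+ x \<in> dyadic_shell k. epowr (ennreal ?c * (\<integral>\<^sup>+ w. g w \<partial>lborel)) p \<partial>(lborel :: (real ^ 'd) measure))"
    using cube_maximal_le_of_far_shell[OF _ g far] p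
    by (intro nn_integral_mono) (auto simp: indicator_def intro!: epowr_mono)
  also have "\<dots> = epowr (ennreal ?c * (\<integral>\<^sup>+ w. g w \<partial>lborel)) p * emeasure lborel (dyadic_shell k :: (real ^ 'd) set)"
    by (rule nn_integral_cmult_indicator) simp
  also have "\<dots> = ennreal (?c powr p) * epowr (\<integral>\<^sup>+ w. g w \<partial>lborel) p * emeasure lborel (dyadic_shell k :: (real ^ 'd) set)"
    by (simp only: epowr_mult epowr_ennreal powr_ge_zero)
  also have "\<dots> \<le> ennreal (?c powr p) * (ennreal (2 powr p * (2 powr (real_of_int i * ?d)) powr (p - 1)) * ?I) *
      ennreal (2 powr (real_of_int k * ?d))"
    by (intro mult_mono hol emeasure_dyadic_shell_le) auto
  also have "\<dots> = ennreal (?c powr p * (2 powr p * (2 powr (real_of_int i * ?d)) powr (p - 1)) * 2 powr (real_of_int k * ?d)) * ?I"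
    by (simp add: ennreal_mult mult_ac)
  also have "?c powr p * (2 powr p * (2 powr (real_of_int i * ?d)) powr (p - 1)) * 2 powr (real_of_int k * ?d) =
      2 powr (3 * ?d * p + p) * shell_decay ?d p (k - i)"
  proof (cases "i \<le> k")
    case True
    then show ?thesis
      by (simp add: shell_decay_def max_def powr_powr powr_add[symmetric]) (simp add: algebra_simps)
  next
    case False
    then show ?thesis
      by (simp add: shell_decay_def max_def powr_powr powr_add[symmetric]) (simp add: algebra_simps)
  qed
  finally show ?thesis .
qed

proposition cube_maximal_shell_estimate:
  assumes p: "1 < p"
  shows "\<exists>K>0. \<forall>(g :: real ^ 'd \<Rightarrow> ennreal) i k. g \<in> borel_measurable borel \<longrightarrow> (\<forall>u. u \<notin> dyadic_shell i \<longrightarrow> g u = 0) \<longrightarrow>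
    (\<integral>\<^sup>+ x \<in> dyadic_shell k. epowr (cube_maximal g x) p \<partial>lborel) \<le>
      ennreal (K * shell_decay (real CARD('d)) p (k - i)) * (\<integral>\<^sup>+ x. epowr (g x) p \<partial>lborel)"
proof -
  let ?d = "real CARD('d)"
  obtain C where C: "0 < C" "\<And>g :: real ^ 'd \<Rightarrow> ennreal. g \<in> borel_measurable borel \<Longrightarrow>
    (\<integral>\<^sup>+ x. epowr (cube_maximal g x) p \<partial>lborel) \<le> ennreal C * (\<integral>\<^sup>+ x. epowr (g x) p \<partial>lborel)"
    using cube_maximal_strong_type[OF p, where 'd = 'd] by auto
  \<comment> \<open>The second entry serves |k - i| \<le> 1: there \<open>shell_decay\<close> is at
    least 2 powr (- d p), so the Hardy-Littlewood constant \<open>C\<close> is absorbed.\<close>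
  define K where "K = max (2 powr (3 * ?d * p + p)) (C * 2 powr (?d * p))"
  have K: "0 < K" by (simp add: K_def less_max_iff_disj)
  have "(\<integral>\<^sup>+ x \<in> dyadic_shell k. epowr (cube_maximal g x) p \<partial>lborel) \<le>
      ennreal (K * shell_decay ?d p (k - i)) * (\<integral>\<^sup>+ x. epowr (g x) p \<partial>lborel)"
    if g: "g \<in> borel_measurable borel" "\<And>u. u \<notin> dyadic_shell i \<Longrightarrow> g u = 0"
    for g :: "real ^ 'd \<Rightarrow> ennreal" and i k
  proof (cases "i + 2 \<le> k \<or> k + 2 \<le> i")
    case True
    have "(\<integral>\<^sup>+ x \<in> dyadic_shell k. epowr (cube_maximal g x) p \<partial>lborel) \<le>
        ennreal (2 powr (3 * ?d * p + p) * shell_decay ?d p (k - i)) * (\<integral>\<^sup>+ x. epowr (g x) p \<partial>lborel)"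
      by (rule cube_maximal_far_shell_estimate[OF p g True])
    also have "\<dots> \<le> ennreal (K * shell_decay ?d p (k - i)) * (\<integral>\<^sup>+ x. epowr (g x) p \<partial>lborel)"
      using shell_decay_pos[of ?d p "k - i"]
      by (intro mult_right_mono ennreal_leI) (auto simp: K_def)
    finally show ?thesis .
  next
    case False
    have "2 powr (- (?d * p)) \<le> shell_decay ?d p (k - i)"
    proof -
      have "k - i = - 1 \<or> k - i = 0 \<or> k - i = 1" using False by auto
      then show ?thesis
        using p powr_mono[of "- (?d * p)" 0 2]
        by (elim disjE) (auto simp: shell_decay_def algebra_simps intro!: powr_mono)
    qed
    then have "C * 2 powr (?d * p) * 2 powr (- (?d * p)) \<le> K * shell_decay ?d p (k - i)"
      using K C(1) by (intro mult_mono) (auto simp: K_def)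
    then have le: "C \<le> K * shell_decay ?d p (k - i)"
      by (simp add: mult.assoc powr_add[symmetric])
    have "(\<integral>\<^sup>+ x \<in> dyadic_shell k. epowr (cube_maximal g x) p \<partial>lborel) \<le> (\<integral>\<^sup>+ x. epowr (cube_maximal g x) p \<partial>lborel)"
      by (intro nn_integral_mono) (simp add: indicator_def)
    also have "\<dots> \<le> ennreal C * (\<integral>\<^sup>+ x. epowr (g x) p \<partial>lborel)" by (rule C(2)[OF g(1)])
    also have "\<dots> \<le> ennreal (K * shell_decay ?d p (k - i)) * (\<integral>\<^sup>+ x. epowr (g x) p \<partial>lborel)"
      using le by (intro mult_right_mono ennreal_leI) auto
    finally show ?thesis .
  qed
  then show ?thesis using K by blast
qed

section \<open>Iterated maximal operator\<close>

lemma cube_maximal_zero [simp]: "cube_maximal (\<lambda>_. 0) x = 0"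
  unfolding cube_maximal_def by (intro antisym SUP_least) auto

definition iterated_maximal ::
  "((real ^ 'n) \<times> (real ^ 'm) \<Rightarrow> ennreal) \<Rightarrow> (real ^ 'n) \<times> (real ^ 'm) \<Rightarrow> ennreal" where
  "iterated_maximal g z = cube_maximal (\<lambda>u. cube_maximal (\<lambda>v. g (u, v)) (snd z)) (fst z)"

lemma cube_maximal_section_measurable [measurable]:
  assumes [measurable]: "g \<in> borel_measurable (borel \<Otimes>\<^sub>M borel)"
  shows "(\<lambda>z. cube_maximal (\<lambda>v. g (fst z, v)) (snd z)) \<in> borel_measurable (borel \<Otimes>\<^sub>M borel)"
  using cube_maximal_measurable_param[of "\<lambda>u v. g (u, v)" borel] by (simp add: case_prod_beta')

lemma iterated_maximal_measurable [measurable]: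
  assumes g[measurable]: "g \<in> borel_measurable (borel \<Otimes>\<^sub>M borel)"
  shows "iterated_maximal g \<in> borel_measurable (borel \<Otimes>\<^sub>M borel)"
proof -
  let ?H = "\<lambda>z. cube_maximal (\<lambda>v. g (fst z, v)) (snd z)"
  have [measurable]: "?H \<in> borel_measurable (borel \<Otimes>\<^sub>M borel)" by measurable
  \<comment> \<open>Swapping the coordinates turns the second variable into the parameter, so that
    joint measurability applies again to the outer operator.\<close>
  have "(\<lambda>(y, u). ?H (u, y)) \<in> borel_measurable (borel \<Otimes>\<^sub>M borel)"
    unfolding case_prod_beta'
    by (rule measurable_compose[of "\<lambda>z. (snd z, fst z)" _ "borel \<Otimes>\<^sub>M borel" ?H]) measurable
  then have "(\<lambda>(y, x). cube_maximal (\<lambda>u. ?H (u, y)) x) \<in> borel_measurable (borel \<Otimes>\<^sub>M borel)"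
    by (intro cube_maximal_measurable_param) simp
  from measurable_compose[OF _ this, of "\<lambda>z. (snd z, fst z)" "borel \<Otimes>\<^sub>M borel"]
  show ?thesis by (simp add: iterated_maximal_def[abs_def])
qed

lemma nn_integral_lborel_pair:
  fixes F :: "'a::euclidean_space \<times> 'b::euclidean_space \<Rightarrow> ennreal"
  assumes F: "F \<in> borel_measurable (borel \<Otimes>\<^sub>M borel)"
  shows "(\<integral>\<^sup>+ z. F z \<partial>lborel) = (\<integral>\<^sup>+ x. \<integral>\<^sup>+ y. F (x, y) \<partial>lborel \<partial>lborel)"
    and "(\<integral>\<^sup>+ z. F z \<partial>lborel) = (\<integral>\<^sup>+ y. \<integral>\<^sup>+ x. F (x, y) \<partial>lborel \<partial>lborel)"
proof -
  have F': "F \<in> borel_measurable (lborel \<Otimes>\<^sub>M lborel)"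
    using F by (simp cong: measurable_cong_sets sets_pair_measure_cong)
  show "(\<integral>\<^sup>+ z. F z \<partial>lborel) = (\<integral>\<^sup>+ x. \<integral>\<^sup>+ y. F (x, y) \<partial>lborel \<partial>lborel)"
    unfolding lborel_prod[symmetric] by (rule lborel.nn_integral_fst[OF F', symmetric])
  show "(\<integral>\<^sup>+ z. F z \<partial>lborel) = (\<integral>\<^sup>+ y. \<integral>\<^sup>+ x. F (x, y) \<partial>lborel \<partial>lborel)"
    unfolding lborel_prod[symmetric] by (rule lborel_pair.nn_integral_snd[OF F', symmetric])
qed

lemma emeasure_lborel_Times:
  fixes A :: "'a::euclidean_space set" and B :: "'b::euclidean_space set"
  assumes "A \<in> sets borel" "B \<in> sets borel"
  shows "emeasure lborel (A \<times> B) = emeasure lborel A * emeasure lborel B"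
  unfolding lborel_prod[symmetric] using assms by (intro lborel.emeasure_pair_measure_Times) auto

text \<open>For each \<open>u\<close> the average over the second factor is at most
  \<open>?H u\<close>, as that cube contains \<open>snd z\<close>; averaging \<open>?H\<close> over
  the first factor, which contains \<open>fst z\<close>, gives the iterated operator.\<close>

lemma rectangle_average_le_iterated_maximal:
  fixes g :: "(real ^ 'n) \<times> (real ^ 'm) \<Rightarrow> ennreal"
  assumes [measurable]: "g \<in> borel_measurable (borel \<Otimes>\<^sub>M borel)"
    and r: "0 < r" "fst z \<in> cube c r" and s: "0 < s" "snd z \<in> cube d s"
  shows "(\<integral>\<^sup>+ w \<in> cube c r \<times> cube d s. g w \<partial>lborel) \<le>
    iterated_maximal g z * emeasure lborel (cube c r \<times> cube d s)"
proof -
  let ?H = "\<lambda>u. cube_maximal (\<lambda>v. g (u, v)) (snd z)"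
  have avg: "(\<integral>\<^sup>+ w \<in> cube c r. h w \<partial>lborel) \<le> cube_maximal h x * emeasure lborel (cube c r)"
    if "0 < r" "x \<in> cube c r" for h and c x :: "real ^ 'k" and r
    using cube_average_le_maximal[OF that, of h]
    by (simp add: ennreal_divide_le_iff[OF emeasure_cube_pos[OF that(1)]])
  have "(\<integral>\<^sup>+ w \<in> cube c r \<times> cube d s. g w \<partial>lborel) =
      (\<integral>\<^sup>+ u. \<integral>\<^sup>+ v. g (u, v) * indicator (cube c r \<times> cube d s) (u, v) \<partial>lborel \<partial>lborel)"
    by (rule nn_integral_lborel_pair) measurable
  also have "\<dots> = (\<integral>\<^sup>+ u. \<integral>\<^sup>+ v. indicator (cube c r) u * (g (u, v) * indicator (cube d s) v) \<partial>lborel \<partial>lborel)"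
    by (intro nn_integral_cong) (auto simp: indicator_def)
  also have "\<dots> = (\<integral>\<^sup>+ u. indicator (cube c r) u * (\<integral>\<^sup>+ v \<in> cube d s. g (u, v) \<partial>lborel) \<partial>lborel)"
    by (intro nn_integral_cong nn_integral_cmult) measurable
  also have "\<dots> \<le> (\<integral>\<^sup>+ u. indicator (cube c r) u * (?H u * emeasure lborel (cube d s)) \<partial>lborel)"
    by (intro nn_integral_mono mult_left_mono avg s) simp
  also have "\<dots> = (\<integral>\<^sup>+ u. emeasure lborel (cube d s) * (?H u * indicator (cube c r) u) \<partial>lborel)"
    by (simp add: mult_ac)
  also have "\<dots> = emeasure lborel (cube d s) * (\<integral>\<^sup>+ u \<in> cube c r. ?H u \<partial>lborel)"
  proof (rule nn_integral_cmult)
    have "?H \<in> borel_measurable borel"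
      using measurable_compose[OF _ cube_maximal_section_measurable[OF assms(1)], of "\<lambda>u. (u, snd z)" borel]
      by simp
    then show "(\<lambda>u. ?H u * indicator (cube c r) u) \<in> borel_measurable lborel" by simp
  qed
  also have "\<dots> \<le> emeasure lborel (cube d s) * (iterated_maximal g z * emeasure lborel (cube c r))"
    unfolding iterated_maximal_def by (intro mult_left_mono avg r) simp
  also have "\<dots> = iterated_maximal g z * emeasure lborel (cube c r \<times> cube d s)"
    by (simp add: emeasure_lborel_Times mult_ac)
  finally show ?thesis .
qed

text \<open>For fixed second variable the one-variable estimate handles the outer operator; after
  exchanging the integrals it handles the inner one on each section of \<open>g\<close>. The
  constants and the decays multiply.\<close>

proposition iterated_maximal_shell_estimate:
  assumes p: "1 < p"
  shows "\<exists>K>0. \<forall>(g :: (real ^ 'n) \<times> (real ^ 'm) \<Rightarrow> ennreal) i j k l. g \<in> borel_measurable (borel \<Otimes>\<^sub>M borel) \<longrightarrow>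
    (\<forall>z. z \<notin> dyadic_shell i \<times> dyadic_shell j \<longrightarrow> g z = 0) \<longrightarrow>
    (\<integral>\<^sup>+ z \<in> dyadic_shell k \<times> dyadic_shell l. epowr (iterated_maximal g z) p \<partial>lborel) \<le>
      ennreal (K * shell_decay (real CARD('n)) p (k - i) * shell_decay (real CARD('m)) p (l - j)) *
      (\<integral>\<^sup>+ z. epowr (g z) p \<partial>lborel)"
proof -
  let ?n = "real CARD('n)" and ?m = "real CARD('m)"
  obtain Kn where Kn: "0 < Kn" and n_est: "\<And>(g :: real ^ 'n \<Rightarrow> ennreal) i k. g \<in> borel_measurable borel \<Longrightarrow>
    (\<And>u. u \<notin> dyadic_shell i \<Longrightarrow> g u = 0) \<Longrightarrow> (\<integral>\<^sup>+ x \<in> dyadic_shell k. epowr (cube_maximal g x) p \<partial>lborel) \<le>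
      ennreal (Kn * shell_decay ?n p (k - i)) * (\<integral>\<^sup>+ x. epowr (g x) p \<partial>lborel)"
    using cube_maximal_shell_estimate[OF p, where 'd = 'n] by auto
  obtain Km where Km: "0 < Km" and m_est: "\<And>(g :: real ^ 'm \<Rightarrow> ennreal) i k. g \<in> borel_measurable borel \<Longrightarrow>
    (\<And>u. u \<notin> dyadic_shell i \<Longrightarrow> g u = 0) \<Longrightarrow> (\<integral>\<^sup>+ x \<in> dyadic_shell k. epowr (cube_maximal g x) p \<partial>lborel) \<le>
      ennreal (Km * shell_decay ?m p (k - i)) * (\<integral>\<^sup>+ x. epowr (g x) p \<partial>lborel)"
    using cube_maximal_shell_estimate[OF p, where 'd = 'm] by auto
  have "(\<integral>\<^sup>+ z \<in> dyadic_shell k \<times> dyadic_shell l. epowr (iterated_maximal g z) p \<partial>lborel) \<le>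
      ennreal (Kn * Km * shell_decay ?n p (k - i) * shell_decay ?m p (l - j)) * (\<integral>\<^sup>+ z. epowr (g z) p \<partial>lborel)"
    if g[measurable]: "g \<in> borel_measurable (borel \<Otimes>\<^sub>M borel)"
      and supp: "\<And>z. z \<notin> dyadic_shell i \<times> dyadic_shell j \<Longrightarrow> g z = 0"
    for g :: "(real ^ 'n) \<times> (real ^ 'm) \<Rightarrow> ennreal" and i j k l
  proof -
    define H where "H z = cube_maximal (\<lambda>v. g (fst z, v)) (snd z)" for z
    have H[measurable]: "H \<in> borel_measurable (borel \<Otimes>\<^sub>M borel)" unfolding H_def by measurable
    let ?a = "ennreal (Kn * shell_decay ?n p (k - i))" and ?b = "ennreal (Km * shell_decay ?m p (l - j))"
    \<comment> \<open>The inner operator does not touch the first variable, so the support in shell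
      \<open>i\<close> survives it, as the outer estimate requires.\<close>
    have H0: "H (u, y) = 0" if "u \<notin> dyadic_shell i" for u y
    proof -
      have "(\<lambda>v. g (u, v)) = (\<lambda>_. 0)" using supp that by auto
      then show ?thesis unfolding H_def by simp
    qed
    have iter: "iterated_maximal g (x, y) = cube_maximal (\<lambda>u. H (u, y)) x" for x y
      by (simp add: iterated_maximal_def H_def)
    have "(\<integral>\<^sup>+ z \<in> dyadic_shell k \<times> dyadic_shell l. epowr (iterated_maximal g z) p \<partial>lborel) =
        (\<integral>\<^sup>+ y. \<integral>\<^sup>+ x. epowr (iterated_maximal g (x, y)) p *
          indicator (dyadic_shell k \<times> dyadic_shell l) (x, y) \<partial>lborel \<partial>lborel)"
      by (rule nn_integral_lborel_pair) measurable
    also have "\<dots> \<le> (\<integral>\<^sup>+ y. \<integral>\<^sup>+ u. ?a * (epowr (H (u, y)) p * indicator (dyadic_shell l) y) \<partial>lborel \<partial>lborel)"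
    proof (rule nn_integral_mono)
      fix y
      show "(\<integral>\<^sup>+ x. epowr (iterated_maximal g (x, y)) p *
          indicator (dyadic_shell k \<times> dyadic_shell l) (x, y) \<partial>lborel) \<le>
          (\<integral>\<^sup>+ u. ?a * (epowr (H (u, y)) p * indicator (dyadic_shell l) y) \<partial>lborel)"
      proof (cases "y \<in> dyadic_shell l")
        case True
        have "(\<integral>\<^sup>+ x \<in> dyadic_shell k. epowr (cube_maximal (\<lambda>u. H (u, y)) x) p \<partial>lborel) \<le>
            ?a * (\<integral>\<^sup>+ u. epowr (H (u, y)) p \<partial>lborel)"
          by (rule n_est) (auto simp: H0)
        then show ?thesis using True by (simp add: iter indicator_times nn_integral_cmult)
      qed (simp add: indicator_times)
    qed
    also have "\<dots> = (\<integral>\<^sup>+ u. \<integral>\<^sup>+ y. ?a * (epowr (H (u, y)) p * indicator (dyadic_shell l) y) \<partial>lborel \<partial>lborel)"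
    proof -
      have "(\<lambda>z. ?a * (epowr (H z) p * indicator (dyadic_shell l) (snd z))) \<in> borel_measurable (borel \<Otimes>\<^sub>M borel)"
        by measurable
      from nn_integral_lborel_pair[OF this] show ?thesis by simp
    qed
    also have "\<dots> = (\<integral>\<^sup>+ u. ?a * (\<integral>\<^sup>+ y \<in> dyadic_shell l. epowr (H (u, y)) p \<partial>lborel) \<partial>lborel)"
      by (intro nn_integral_cong nn_integral_cmult) measurable
    also have "\<dots> \<le> (\<integral>\<^sup>+ u. ?a * (?b * (\<integral>\<^sup>+ v. epowr (g (u, v)) p \<partial>lborel)) \<partial>lborel)"
    proof (intro nn_integral_mono mult_left_mono)
      fix u
      show "(\<integral>\<^sup>+ y \<in> dyadic_shell l. epowr (H (u, y)) p \<partial>lborel) \<le> ?b * (\<integral>\<^sup>+ v. epowr (g (u, v)) p \<partial>lborel)"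
        unfolding H_def fst_conv snd_conv by (rule m_est) (auto intro!: supp)
    qed simp
    also have "\<dots> = ?a * (?b * (\<integral>\<^sup>+ u. \<integral>\<^sup>+ v. epowr (g (u, v)) p \<partial>lborel \<partial>lborel))"
    proof -
      have "(\<lambda>u. \<integral>\<^sup>+ v. epowr (g (u, v)) p \<partial>lborel) \<in> borel_measurable borel"
        by (rule lborel.borel_measurable_nn_integral) (simp add: case_prod_beta' cong: measurable_cong_sets sets_pair_measure_cong)
      then show ?thesis by (simp add: nn_integral_cmult)
    qed
    also have "(\<integral>\<^sup>+ u. \<integral>\<^sup>+ v. epowr (g (u, v)) p \<partial>lborel \<partial>lborel) = (\<integral>\<^sup>+ z. epowr (g z) p \<partial>lborel)"
      by (rule nn_integral_lborel_pair[symmetric]) measurable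
    also have "?a * (?b * (\<integral>\<^sup>+ z. epowr (g z) p \<partial>lborel)) =
        ennreal (Kn * Km * shell_decay ?n p (k - i) * shell_decay ?m p (l - j)) * (\<integral>\<^sup>+ z. epowr (g z) p \<partial>lborel)"
      using Kn Km shell_decay_pos[of ?n p "k - i"] shell_decay_pos[of ?m p "l - j"]
      by (simp add: ennreal_mult mult_ac)
    finally show ?thesis .
  qed
  then show ?thesis using Kn Km by (intro exI[of _ "Kn * Km"]) auto
qed

section \<open>Shells partition the space up to a null set\<close>

lemma ex_dyadic_shell:
  fixes x :: "real ^ 'd"
  assumes "x \<noteq> 0"
  shows "\<exists>k. x \<in> dyadic_shell k"
proof -
  define N where "N = Max (range (\<lambda>i. \<bar>x $ i\<bar>))"
  have le: "\<bar>x $ i\<bar> \<le> N" for i unfolding N_def by (intro Max_ge) auto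
  have "N \<in> range (\<lambda>i. \<bar>x $ i\<bar>)" unfolding N_def by (intro Max_in) auto
  then obtain j where j: "N = \<bar>x $ j\<bar>" by auto
  obtain i where "x $ i \<noteq> 0" using assms by (auto simp: vec_eq_iff)
  then have N: "0 < N" using le[of i] by linarith
  \<comment> \<open>\<open>2 * N\<close>, because the cube of side 2^k reaches only to 2^(k - 1) in
    each coordinate.\<close>
  define k where "k = \<lceil>log 2 (2 * N)\<rceil>"
  have "log 2 (2 * N) \<le> real_of_int k" "real_of_int k - 1 < log 2 (2 * N)"
    unfolding k_def by linarith+
  then have k: "2 * N \<le> 2 powr real_of_int k" "2 powr (real_of_int k - 1) < 2 * N"
    using N by (simp_all add: log_le_iff less_log_iff)
  show ?thesis
    unfolding mem_dyadic_shell
  proof (intro exI[of _ k] conjI allI)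
    show "\<bar>x $ i\<bar> \<le> 2 powr real_of_int k / 2" for i using le[of i] k(1) by simp
    show "\<exists>i. 2 powr (real_of_int k - 1) / 2 < \<bar>x $ i\<bar>" using k(2) j by (intro exI[of _ j]) simp
  qed
qed

lemma dyadic_cube_mono: "k \<le> l \<Longrightarrow> dyadic_cube k \<subseteq> dyadic_cube l"
proof
  fix x :: "real ^ 'd" assume "k \<le> l" and x: "x \<in> dyadic_cube k"
  then have "2 powr real_of_int k / 2 \<le> 2 powr real_of_int l / 2" by (intro divide_right_mono powr_mono) auto
  then show "x \<in> dyadic_cube l" using x unfolding mem_dyadic_cube by (meson order_trans)
qed

lemma dyadic_shell_le_of_mem_cube:
  assumes "x \<in> dyadic_shell k" "x \<in> dyadic_cube l"
  shows "k \<le> l"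
proof (rule ccontr)
  assume "\<not> k \<le> l"
  then have "dyadic_cube l \<subseteq> (dyadic_cube (k - 1) :: (real ^ 'a) set)" by (intro dyadic_cube_mono) auto
  then show False using assms by (auto simp: dyadic_shell_def)
qed

lemma dyadic_shell_unique:
  assumes "x \<in> dyadic_shell k" "x \<in> dyadic_shell l"
  shows "k = l"
  using dyadic_shell_le_of_mem_cube[of x k l] dyadic_shell_le_of_mem_cube[of x l k] assms
  by (auto simp: dyadic_shell_def)

text \<open>No shell contains the origin, so the product shells cover exactly the points with both
  components nonzero; only this null set is lost.\<close>

lemma AE_coordinates_nonzero:
  "AE z in (lborel :: ('a::euclidean_space \<times> 'b::euclidean_space) measure). fst z \<noteq> 0 \<and> snd z \<noteq> 0"
proof (rule AE_I)
  let ?N = "{0} \<times> UNIV \<union> UNIV \<times> {0} :: ('a \<times> 'b) set"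
  show "{z \<in> space lborel. \<not> (fst z \<noteq> 0 \<and> snd z \<noteq> 0)} \<subseteq> ?N" by auto
  have "emeasure lborel ({0} \<times> (UNIV :: 'b set) :: ('a \<times> 'b) set) = 0"
    "emeasure lborel ((UNIV :: 'a set) \<times> {0} :: ('a \<times> 'b) set) = 0"
    by (simp_all add: emeasure_lborel_Times)
  then have "?N \<in> null_sets lborel"
    by (intro null_sets.Un null_setsI) (auto simp: borel_prod[symmetric])
  then show "emeasure lborel ?N = 0" "?N \<in> sets lborel" by (auto simp: null_sets_def)
qed

section \<open>Lower semicontinuity of the strong maximal function\<close>

lemma less_strong_maximal_iff:
  fixes f :: "(real ^ 'n) \<times> (real ^ 'm) \<Rightarrow> complex"
  shows "t < strong_maximal f z \<longleftrightarrow> (\<exists>x r y s. 0 < r \<and> 0 < s \<and> fst z \<in> cube x r \<and> snd z \<in> cube y s \<and>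
    t * ennreal (r ^ CARD('n) * s ^ CARD('m)) < (\<integral>\<^sup>+ w \<in> cube x r \<times> cube y s. ennreal (norm (f w)) \<partial>lborel))"
proof -
  have *: "t < (\<integral>\<^sup>+ w \<in> cube x r \<times> cube y s. ennreal (norm (f w)) \<partial>lebesgue) / emeasure lebesgue (cube x r \<times> cube y s)
      \<longleftrightarrow> t * ennreal (r ^ CARD('n) * s ^ CARD('m)) < (\<integral>\<^sup>+ w \<in> cube x r \<times> cube y s. ennreal (norm (f w)) \<partial>lborel)"
    if "0 < r" "0 < s" for x :: "real ^ 'n" and y :: "real ^ 'm" and r s
  proof -
    have "cube x r \<times> cube y s \<in> sets (lborel :: ((real ^ 'n) \<times> (real ^ 'm)) measure)"
      by (simp add: borel_prod[symmetric])
    then have "emeasure lebesgue (cube x r \<times> cube y s) = ennreal (r ^ CARD('n) * s ^ CARD('m))"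
      using that by (simp add: emeasure_lborel_Times emeasure_cube ennreal_mult)
    \<comment> \<open>The nonnegative integral with respect to a completion equals the original one
      for every function, measurable or not.\<close>
    then show ?thesis
      using that by (simp only: nn_integral_completion) (rule ennreal_less_divide_iff; simp)
  qed
  show ?thesis
  proof
    assume "t < strong_maximal f z"
    then obtain R where R: "R \<in> rectangles" "z \<in> R"
      "t < (\<integral>\<^sup>+ w \<in> R. ennreal (norm (f w)) \<partial>lebesgue) / emeasure lebesgue R"
      unfolding strong_maximal_def less_SUP_iff by blast
    then obtain x r y s where "R = cube x r \<times> cube y s" "0 < r" "0 < s"
      unfolding rectangles_def by blast
    then show "\<exists>x r y s. 0 < r \<and> 0 < s \<and> fst z \<in> cube x r \<and> snd z \<in> cube y s \<and>
        t * ennreal (r ^ CARD('n) * s ^ CARD('m)) < (\<integral>\<^sup>+ w \<in> cube x r \<times> cube y s. ennreal (norm (f w)) \<partial>lborel)"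
      using R *[of r s x y] by (intro exI[of _ x] exI[of _ r] exI[of _ y] exI[of _ s]) (simp add: mem_Times_iff)
  next
    assume "\<exists>x r y s. 0 < r \<and> 0 < s \<and> fst z \<in> cube x r \<and> snd z \<in> cube y s \<and>
        t * ennreal (r ^ CARD('n) * s ^ CARD('m)) < (\<integral>\<^sup>+ w \<in> cube x r \<times> cube y s. ennreal (norm (f w)) \<partial>lborel)"
    then obtain x r y s where a: "0 < r" "0 < s" "fst z \<in> cube x r" "snd z \<in> cube y s"
      "t * ennreal (r ^ CARD('n) * s ^ CARD('m)) < (\<integral>\<^sup>+ w \<in> cube x r \<times> cube y s. ennreal (norm (f w)) \<partial>lborel)"
      by blast
    then have "cube x r \<times> cube y s \<in> {R \<in> rectangles. z \<in> R}"
      unfolding rectangles_def mem_Collect_eq mem_Times_iff by blast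
    moreover note *[OF a(1,2), THEN iffD2, OF a(5)]
    ultimately show "t < strong_maximal f z"
      unfolding strong_maximal_def less_SUP_iff by (rule bexI[rotated])
  qed
qed

text \<open>A slightly enlarged rectangle still has average above \<open>t\<close>, and it contains
  a whole neighbourhood of the point. Measurability of the maximal function follows.\<close>

lemma open_strong_maximal_gt:
  fixes f :: "(real ^ 'n) \<times> (real ^ 'm) \<Rightarrow> complex"
  shows "open {z. t < strong_maximal f z}"
  unfolding open_contains_ball
proof
  fix z assume "z \<in> {z. t < strong_maximal f z}"
  then obtain x r y s where a: "0 < r" "0 < s" "fst z \<in> cube x r" "snd z \<in> cube y s"
    "t * ennreal (r ^ CARD('n) * s ^ CARD('m)) < (\<integral>\<^sup>+ w \<in> cube x r \<times> cube y s. ennreal (norm (f w)) \<partial>lborel)"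
    unfolding mem_Collect_eq less_strong_maximal_iff by blast
  let ?I = "\<integral>\<^sup>+ w \<in> cube x r \<times> cube y s. ennreal (norm (f w)) \<partial>lborel"
  obtain e where e: "0 < e" "\<And>e'. 0 < e' \<Longrightarrow> e' < 0 + e \<Longrightarrow>
      t * ennreal ((r + e') ^ CARD('n) * (s + e') ^ CARD('m)) < ?I"
    using ex_larger_factor[of t "\<lambda>e. (r + e) ^ CARD('n) * (s + e) ^ CARD('m)" 0 ?I] a by auto
  have mono: "cube c \<rho> \<subseteq> cube c (\<rho> + e / 2)" for c :: "real ^ 'k" and \<rho>
  proof -
    have "\<rho> / 2 \<le> (\<rho> + e / 2) / 2" using e(1) by simp
    then show ?thesis unfolding mem_cube subset_iff by (meson order_trans)
  qed
  have "?I \<le> (\<integral>\<^sup>+ w \<in> cube x (r + e / 2) \<times> cube y (s + e / 2). ennreal (norm (f w)) \<partial>lborel)"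
    using mono[of x r] mono[of y s] by (intro nn_integral_mono mult_left_mono) (auto simp: indicator_def)
  then have big: "t * ennreal ((r + e / 2) ^ CARD('n) * (s + e / 2) ^ CARD('m)) <
      (\<integral>\<^sup>+ w \<in> cube x (r + e / 2) \<times> cube y (s + e / 2). ennreal (norm (f w)) \<partial>lborel)"
    using e(2)[of "e / 2"] e(1) by (auto intro: less_le_trans)
  \<comment> \<open>Sides grow by e / 2, hence half sides by e / 4, which is the radius of the ball
    used below.\<close>
  have near: "w \<in> cube c (\<rho> + e / 2)" if "v \<in> cube c \<rho>" "dist v w < e / 4" for v w c :: "real ^ 'k" and \<rho>
    unfolding mem_cube
  proof
    fix i
    have "\<bar>v $ i - c $ i\<bar> \<le> \<rho> / 2" "\<bar>v $ i - w $ i\<bar> < e / 4"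
      using that vec_nth_dist_le[of v i w] by (auto simp: mem_cube)
    then show "\<bar>w $ i - c $ i\<bar> \<le> (\<rho> + e / 2) / 2" unfolding abs_le_iff abs_less_iff by argo
  qed
  show "\<exists>\<epsilon>>0. ball z \<epsilon> \<subseteq> {z. t < strong_maximal f z}"
  proof (intro exI[of _ "e / 4"] conjI subsetI)
    fix w assume w: "w \<in> ball z (e / 4)"
    have "fst w \<in> cube x (r + e / 2)" "snd w \<in> cube y (s + e / 2)"
      using w dist_fst_le[of z w] dist_snd_le[of z w] by (auto intro!: near[OF a(3)] near[OF a(4)])
    moreover have "0 < r + e / 2" "0 < s + e / 2" using a e(1) by auto
    ultimately show "w \<in> {z. t < strong_maximal f z}"
      unfolding mem_Collect_eq less_strong_maximal_iff using big by blast
  qed (use e(1) in simp)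
qed

lemma strong_maximal_measurable [measurable]: "strong_maximal f \<in> borel_measurable borel"
  by (rule borel_measurableI_greater) (simp add: open_strong_maximal_gt borel_open)

section \<open>Herz norms and blocks\<close>

lemma le_infsum_ennreal: "f x \<le> (\<Sum>\<^sub>\<infinity>x\<in>UNIV. f x)" for f :: "'a \<Rightarrow> ennreal"
proof -
  have "sum f {x} \<le> (SUP F\<in>{F. finite F \<and> F \<subseteq> UNIV}. sum f F)" by (rule SUP_upper) simp
  then show ?thesis by (simp add: nonneg_infsum_complete)
qed

lemma infsum_single_ennreal:
  fixes f :: "'a \<Rightarrow> ennreal"
  assumes "\<And>y. y \<noteq> x \<Longrightarrow> f y = 0"
  shows "(\<Sum>\<^sub>\<infinity>y\<in>UNIV. f y) = f x"
proof -
  have "infsum f UNIV = infsum f {x}"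
    using assms by (intro infsum_cong_neutral) auto
  then show ?thesis by simp
qed

text \<open>A single term of the Herz sum is at most the whole sum, and the outer root undoes the
  power \<open>q\<close> of that term.\<close>

lemma Lp_norm_shell_le_of_herz_norm_le:
  fixes b :: "(real ^ 'n) \<times> (real ^ 'm) \<Rightarrow> complex"
  assumes p: "0 < p" and q: "0 < q" and B: "0 \<le> B" and le: "herz_norm \<alpha> p q b \<le> ennreal B"
  shows "(\<integral>\<^sup>+ z. ennreal (norm (b z * indicator (dyadic_shell i \<times> dyadic_shell j) z) powr p) \<partial>lborel) \<le>
    ennreal ((2 powr (- real_of_int (i + j) * \<alpha>) * B) powr p)"
proof -
  let ?J = "\<integral>\<^sup>+ z. ennreal (norm (b z * indicator (dyadic_shell i \<times> dyadic_shell j) z) powr p) \<partial>lborel"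
  let ?c = "2 powr (real_of_int (i + j) * \<alpha>)"
  let ?T = "\<lambda>(i, j). ennreal (2 powr (real_of_int (i + j) * q * \<alpha>)) *
    epowr (Lp_norm p (\<lambda>z. b z * indicator (dyadic_shell i \<times> dyadic_shell j) z)) q"
  have "ennreal ?c * epowr ?J (1 / p) = epowr (?T (i, j)) (1 / q)"
    using q by (simp add: Lp_norm_def nn_integral_completion epowr_mult epowr_epowr epowr_ennreal powr_powr mult_ac)
  also have "\<dots> \<le> herz_norm \<alpha> p q b"
    unfolding herz_norm_def using q le_infsum_ennreal[of ?T "(i, j)"] by (intro epowr_mono) auto
  finally have "ennreal ?c * epowr ?J (1 / p) \<le> ennreal B" using le by (rule order_trans)
  then have "epowr (ennreal ?c * epowr ?J (1 / p)) p \<le> epowr (ennreal B) p"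
    using p by (intro epowr_mono) auto
  then have "ennreal (?c powr p) * ?J \<le> ennreal (B powr p)"
    using p B by (simp add: epowr_mult epowr_epowr epowr_ennreal)
  then have "ennreal ((2 powr (- real_of_int (i + j) * \<alpha>)) powr p) * (ennreal (?c powr p) * ?J) \<le>
      ennreal ((2 powr (- real_of_int (i + j) * \<alpha>)) powr p) * ennreal (B powr p)"
    by (rule mult_left_mono) simp
  moreover have "ennreal ((2 powr (- real_of_int (i + j) * \<alpha>)) powr p) * ennreal (?c powr p) = 1"
  proof -
    have "(2 powr (- real_of_int (i + j) * \<alpha>)) powr p * ?c powr p = 1"
      by (simp only: powr_powr powr_add[symmetric] minus_mult_left[symmetric]) simp
    then show ?thesis by (simp only: ennreal_mult[symmetric] powr_ge_zero ennreal_1)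
  qed
  ultimately show ?thesis
    using B by (simp add: mult.assoc[symmetric]) (simp add: ennreal_mult powr_mult)
qed

text \<open>Shells are disjoint, so the Herz sum collapses to the term (i, j), on which the power
  \<open>q\<close> and its root cancel.\<close>

lemma herz_norm_le_of_single_shell:
  fixes b :: "(real ^ 'n) \<times> (real ^ 'm) \<Rightarrow> complex"
  assumes p: "0 < p" and q: "0 < q" and B: "0 \<le> B"
    and supp: "\<And>z. z \<notin> dyadic_shell i \<times> dyadic_shell j \<Longrightarrow> b z = 0"
    and le: "(\<integral>\<^sup>+ z. ennreal (norm (b z) powr p) \<partial>lborel) \<le> ennreal (B powr p)"
  shows "herz_norm \<alpha> p q b \<le> ennreal (2 powr (real_of_int (i + j) * \<alpha>) * B)"
proof -
  let ?b = "\<lambda>k l z. b z * indicator (dyadic_shell k \<times> dyadic_shell l) z"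
  let ?T = "\<lambda>x. case x of (k, l) \<Rightarrow> ennreal (2 powr (real_of_int (k + l) * q * \<alpha>)) * epowr (Lp_norm p (?b k l)) q"
  have "?T x = 0" if "x \<noteq> (i, j)" for x
  proof (cases x)
    case (Pair k l)
    have eq: "?b k l = (\<lambda>_. 0)"
    proof
      fix z
      show "?b k l z = 0"
        using that Pair supp[of z] dyadic_shell_unique[of "fst z" i k] dyadic_shell_unique[of "snd z" j l]
        by (cases z) (auto simp: indicator_def)
    qed
    show ?thesis unfolding Pair prod.case eq by (simp add: Lp_norm_def)
  qed
  then have "infsum ?T UNIV = ?T (i, j)" by (rule infsum_single_ennreal)
  moreover have "?b i j = b"
  proof
    show "?b i j z = b z" for z using supp[of z] by (cases "z \<in> dyadic_shell i \<times> dyadic_shell j") auto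
  qed
  ultimately have "herz_norm \<alpha> p q b = epowr (ennreal (2 powr (real_of_int (i + j) * q * \<alpha>)) * epowr (Lp_norm p b) q) (1 / q)"
    by (simp add: herz_norm_def)
  also have "\<dots> = ennreal (2 powr (real_of_int (i + j) * \<alpha>)) * epowr (\<integral>\<^sup>+ z. ennreal (norm (b z) powr p) \<partial>lborel) (1 / p)"
    using q by (simp add: epowr_mult epowr_epowr epowr_ennreal powr_powr Lp_norm_def nn_integral_completion)
  also have "\<dots> \<le> ennreal (2 powr (real_of_int (i + j) * \<alpha>)) * epowr (ennreal (B powr p)) (1 / p)"
    using p by (intro mult_left_mono epowr_mono le) auto
  also have "\<dots> = ennreal (2 powr (real_of_int (i + j) * \<alpha>) * B)"
    using p B by (simp add: epowr_ennreal powr_powr ennreal_mult)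
  finally show ?thesis .
qed

text \<open>Countable sublinearity: integrate the domination over a rectangle, exchange sum and
  integral, and bound each average. Averages ignore null sets, so an almost everywhere hypothesis
  yields a bound at every \<open>z\<close>.\<close>

lemma strong_maximal_le_nn_integral_iterated:
  fixes f :: "(real ^ 'n) \<times> (real ^ 'm) \<Rightarrow> complex"
  assumes I: "countable (UNIV :: 'i set)"
    and G[measurable]: "\<And>i :: 'i. G i \<in> borel_measurable (borel \<Otimes>\<^sub>M borel)"
    and f: "AE w in lborel. ennreal (norm (f w)) \<le> (\<integral>\<^sup>+ i. c i * G i w \<partial>count_space UNIV)"
  shows "strong_maximal f z \<le> (\<integral>\<^sup>+ i. c i * iterated_maximal (G i) z \<partial>count_space UNIV)" (is "_ \<le> ?S")
proof (rule dense_le)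
  fix t assume "t < strong_maximal f z"
  then obtain x r y s where a: "0 < r" "fst z \<in> cube x r" "0 < s" "snd z \<in> cube y s"
    "t * ennreal (r ^ CARD('n) * s ^ CARD('m)) < (\<integral>\<^sup>+ w \<in> cube x r \<times> cube y s. ennreal (norm (f w)) \<partial>lborel)"
    unfolding less_strong_maximal_iff by blast
  let ?R = "cube x r \<times> cube y s"
  have R: "emeasure lborel ?R = ennreal (r ^ CARD('n) * s ^ CARD('m))"
    using a by (simp add: emeasure_lborel_Times emeasure_cube ennreal_mult)
  have [measurable]: "G i \<in> borel_measurable lborel" for i
    using G by (simp add: borel_prod)
  have [measurable]: "?R \<in> sets lborel"
    by (simp add: borel_prod[symmetric])
  have "(\<integral>\<^sup>+ w \<in> ?R. ennreal (norm (f w)) \<partial>lborel) \<le> (\<integral>\<^sup>+ w. (\<integral>\<^sup>+ i. c i * G i w \<partial>count_space UNIV) * indicator ?R w \<partial>lborel)"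
    using f by (intro nn_integral_mono_AE) (auto simp: indicator_def)
  also have "\<dots> = (\<integral>\<^sup>+ w. \<integral>\<^sup>+ i. c i * (G i w * indicator ?R w) \<partial>count_space UNIV \<partial>lborel)"
    by (simp add: nn_integral_multc[symmetric] mult.assoc)
  also have "\<dots> = (\<integral>\<^sup>+ i. \<integral>\<^sup>+ w. c i * (G i w * indicator ?R w) \<partial>lborel \<partial>count_space UNIV)"
    by (rule nn_integral_count_space_nn_integral[OF I]) measurable
  also have "\<dots> = (\<integral>\<^sup>+ i. c i * (\<integral>\<^sup>+ w \<in> ?R. G i w \<partial>lborel) \<partial>count_space UNIV)"
    by (intro nn_integral_cong nn_integral_cmult) measurable
  also have "\<dots> \<le> (\<integral>\<^sup>+ i. c i * (iterated_maximal (G i) z * emeasure lborel ?R) \<partial>count_space UNIV)"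
    by (intro nn_integral_mono mult_left_mono rectangle_average_le_iterated_maximal G a) simp
  also have "\<dots> = ?S * emeasure lborel ?R"
    by (simp add: nn_integral_multc[symmetric] mult.assoc)
  finally have le: "(\<integral>\<^sup>+ w \<in> ?R. ennreal (norm (f w)) \<partial>lborel) \<le> ?S * emeasure lborel ?R" .
  show "t \<le> ?S"
  proof (rule ccontr)
    assume "\<not> t \<le> ?S"
    then have "?S * emeasure lborel ?R \<le> t * emeasure lborel ?R" by (intro mult_right_mono) auto
    with le have "(\<integral>\<^sup>+ w \<in> ?R. ennreal (norm (f w)) \<partial>lborel) \<le> t * emeasure lborel ?R" by (rule order_trans)
    then show False using a(5) unfolding R by simp
  qed
qed

section \<open>From domination by single-shell functions to block representations\<close>

lemma sums_enn2real:
  assumes "\<And>n. 0 \<le> r n" "(\<Sum>n. ennreal (r n)) = x" "x < top"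
  shows "r sums enn2real x"
proof -
  have top: "(\<Sum>n. ennreal (r n)) \<noteq> top" unfolding assms(2) using assms(3) by simp
  have s: "summable r" by (rule summable_suminf_not_top[OF assms(1) top])
  have "x = ennreal (suminf r)" using suminf_ennreal2[OF assms(1) s] assms(2) by simp
  then have "enn2real x = suminf r" using suminf_nonneg[OF s assms(1)] by simp
  then show ?thesis using summable_sums[OF s] by (simp only:)
qed

text \<open>\<open>enn2real\<close> sends \<open>top\<close> to 0, which can only lower the left
  side.\<close>

lemma ennreal_norm_powr_le_epowr:
  assumes "x \<le> y" "0 \<le> p"
  shows "ennreal (norm (complex_of_real (enn2real x)) powr p) \<le> epowr y p"
proof -
  have "ennreal (norm (complex_of_real (enn2real x)) powr p) \<le> epowr x p"
    by (cases x) (auto simp: epowr_ennreal)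
  also have "\<dots> \<le> epowr y p" using assms by (intro epowr_mono)
  finally show ?thesis .
qed

text \<open>On one product shell, which has finite measure, the normalised pieces have L^1 norms
  bounded uniformly, since the L^p bound \<open>B\<close> depends on the shell alone. With summable
  weights the series is integrable there, and countably many shells cover almost every
  point.\<close>

lemma AE_series_finite:
  fixes h :: "'i \<Rightarrow> (real ^ 'n) \<times> (real ^ 'm) \<Rightarrow> ennreal" and c \<mu> :: "'i \<Rightarrow> real" and s t :: "'i \<Rightarrow> int"
  assumes I: "countable (UNIV :: 'i set)" and p: "1 \<le> p" and c: "\<And>i. 0 \<le> c i" and \<mu>: "\<And>i. 0 < \<mu> i"
    and h[measurable]: "\<And>i. h i \<in> borel_measurable borel"
    and supp: "\<And>i z. z \<notin> dyadic_shell (s i) \<times> dyadic_shell (t i) \<Longrightarrow> h i z = 0"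
    and bound: "\<And>i. (\<integral>\<^sup>+ z. epowr (ennreal (1 / \<mu> i) * h i z) p \<partial>lborel) \<le> ennreal (B (s i) (t i))"
    and fin: "(\<integral>\<^sup>+ i. ennreal (c i * \<mu> i) \<partial>count_space UNIV) < top"
  shows "AE z in lborel. (\<integral>\<^sup>+ i. ennreal (c i) * h i z \<partial>count_space UNIV) < top"
proof -
  let ?D = "\<lambda>z. \<integral>\<^sup>+ i. ennreal (c i) * h i z \<partial>count_space UNIV"
  have [measurable]: "?D \<in> borel_measurable lborel"
    by (rule borel_measurable_nn_integral_countable[OF I]) measurable
  have shells: "dyadic_shell k \<times> dyadic_shell l \<in> sets (lborel :: ((real ^ 'n) \<times> (real ^ 'm)) measure)" for k l
    by (simp add: borel_prod[symmetric])
  have local_finite: "AE z in lborel. z \<in> dyadic_shell k \<times> dyadic_shell l \<longrightarrow> ?D z < top" for k l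
  proof -
    let ?E = "dyadic_shell k \<times> dyadic_shell l :: ((real ^ 'n) \<times> (real ^ 'm)) set"
    note shells[of k l, measurable]
    \<comment> \<open>The integral over the shell of y \<le> 1 + y^p for the normalised piece
      y.\<close>
    define M where "M = emeasure lborel ?E + ennreal (B k l)"
    have "emeasure lborel ?E < top"
      using emeasure_dyadic_shell_le[of k, where 'd = 'n] emeasure_dyadic_shell_le[of l, where 'd = 'm]
      by (auto simp: emeasure_lborel_Times ennreal_mult_less_top intro: le_less_trans)
    then have M: "M < top" by (simp add: M_def)
    have piece: "(\<integral>\<^sup>+ z \<in> ?E. h i z \<partial>lborel) \<le> ennreal (\<mu> i) * M" for i
    proof (cases "s i = k \<and> t i = l")
      case True
      have "(\<integral>\<^sup>+ z \<in> ?E. h i z \<partial>lborel) \<le>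
          (\<integral>\<^sup>+ z. ennreal (\<mu> i) * (indicator ?E z + epowr (ennreal (1 / \<mu> i) * h i z) p) \<partial>lborel)"
      proof (rule nn_integral_mono)
        fix z
        have "h i z = ennreal (\<mu> i) * (ennreal (1 / \<mu> i) * h i z)"
          using \<mu>[of i] by (simp add: mult.assoc[symmetric] ennreal_mult[symmetric])
        also have "\<dots> \<le> ennreal (\<mu> i) * (ennreal 1 + ennreal (1 powr (1 - p)) * epowr (ennreal (1 / \<mu> i) * h i z) p)"
          using p by (intro mult_left_mono ennreal_le_add_epowr) auto
        finally show "h i z * indicator ?E z \<le> ennreal (\<mu> i) * (indicator ?E z + epowr (ennreal (1 / \<mu> i) * h i z) p)"
          by (cases "z \<in> ?E") auto
      qed
      also have "\<dots> = ennreal (\<mu> i) * (emeasure lborel ?E + (\<integral>\<^sup>+ z. epowr (ennreal (1 / \<mu> i) * h i z) p \<partial>lborel))"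
        by (simp add: nn_integral_cmult nn_integral_add nn_integral_indicator[OF shells[of k l]])
      also have "\<dots> \<le> ennreal (\<mu> i) * M"
        unfolding M_def using bound[of i] True by (intro mult_left_mono add_left_mono) auto
      finally show ?thesis .
    next
      case False
      have "h i z * indicator ?E z = 0" for z
        using False supp[of z i] dyadic_shell_unique[of "fst z" k "s i"] dyadic_shell_unique[of "snd z" l "t i"]
        by (cases z) (auto simp: indicator_def)
      then show ?thesis by (simp only: nn_integral_const mult_zero_left) simp
    qed
    have "(\<integral>\<^sup>+ z \<in> ?E. ?D z \<partial>lborel) = (\<integral>\<^sup>+ z. \<integral>\<^sup>+ i. ennreal (c i) * (h i z * indicator ?E z) \<partial>count_space UNIV \<partial>lborel)"
      by (simp add: nn_integral_multc[symmetric] mult.assoc)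
    also have "\<dots> = (\<integral>\<^sup>+ i. \<integral>\<^sup>+ z. ennreal (c i) * (h i z * indicator ?E z) \<partial>lborel \<partial>count_space UNIV)"
      by (rule nn_integral_count_space_nn_integral[OF I]) measurable
    also have "\<dots> = (\<integral>\<^sup>+ i. ennreal (c i) * (\<integral>\<^sup>+ z \<in> ?E. h i z \<partial>lborel) \<partial>count_space UNIV)"
      by (intro nn_integral_cong nn_integral_cmult) measurable
    also have "\<dots> \<le> (\<integral>\<^sup>+ i. ennreal (c i) * (ennreal (\<mu> i) * M) \<partial>count_space UNIV)"
      by (intro nn_integral_mono mult_left_mono piece) simp
    also have "\<dots> = (\<integral>\<^sup>+ i. ennreal (c i * \<mu> i) \<partial>count_space UNIV) * M"
      using c \<mu> by (simp add: nn_integral_multc[symmetric] ennreal_mult less_imp_le mult.assoc)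
    also have "\<dots> < top" using fin M by (simp add: ennreal_mult_less_top)
    finally have "AE z in lborel. ?D z * indicator ?E z \<noteq> \<infinity>"
      by (intro nn_integral_noteq_infinite) auto
    then show ?thesis by eventually_elim (auto simp: indicator_def less_top)
  qed
  then have "AE z in lborel. \<forall>k l. z \<in> dyadic_shell k \<times> dyadic_shell l \<longrightarrow> ?D z < top"
    unfolding AE_all_countable by blast
  then show ?thesis using AE_coordinates_nonzero
  proof eventually_elim
    case (elim z)
    then obtain k l where "fst z \<in> dyadic_shell k" "snd z \<in> dyadic_shell l"
      using ex_dyadic_shell by meson
    then show ?case using elim by (auto simp: mem_Times_iff)
  qed
qed

text \<open>The lattice property of blocks: multiplying every term of a dominating series by the quotient of
  the two sides turns the domination into a representation.\<close>

lemma block_rep_of_dominated: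
  fixes h :: "'i \<Rightarrow> (real ^ 'n) \<times> (real ^ 'm) \<Rightarrow> ennreal" and c \<mu> :: "'i \<Rightarrow> real" and s t :: "'i \<Rightarrow> int"
  assumes I: "countable (UNIV :: 'i set)" "infinite (UNIV :: 'i set)"
    and p: "1 \<le> p" and q: "0 < q" and c: "\<And>i. 0 \<le> c i" and \<mu>: "\<And>i. 0 < \<mu> i"
    and h[measurable]: "\<And>i. h i \<in> borel_measurable borel"
    and supp: "\<And>i z. z \<notin> dyadic_shell (s i) \<times> dyadic_shell (t i) \<Longrightarrow> h i z = 0"
    and bound: "\<And>i. (\<integral>\<^sup>+ z. epowr (h i z) p \<partial>lborel) \<le>
      ennreal ((\<mu> i * 2 powr (- (\<alpha> + lam) * real_of_int (s i + t i))) powr p)"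
    and S: "(\<integral>\<^sup>+ i. ennreal (c i * \<mu> i) \<partial>count_space UNIV) = ennreal S" "0 \<le> S"
    and F[measurable]: "F \<in> borel_measurable borel"
    and dom: "AE z in lborel. F z \<le> (\<integral>\<^sup>+ i. ennreal (c i) * h i z \<partial>count_space UNIV)"
  shows "AE z in lborel. F z < top"
    and "\<exists>c' b. block_rep \<alpha> p q lam (\<lambda>z. complex_of_real (enn2real (F z))) c' b \<and> (\<Sum>n. norm (c' n)) = S"
proof -
  let ?D = "\<lambda>z. \<integral>\<^sup>+ i. ennreal (c i) * h i z \<partial>count_space UNIV"
  let ?B = "\<lambda>i. 2 powr (- (\<alpha> + lam) * real_of_int (s i + t i))"
  have D[measurable]: "?D \<in> borel_measurable borel"
    by (rule borel_measurable_nn_integral_countable[OF I(1)]) measurable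
  have bound': "(\<integral>\<^sup>+ z. epowr (ennreal (1 / \<mu> i) * h i z) p \<partial>lborel) \<le> ennreal (?B i powr p)" for i
  proof -
    have "(\<integral>\<^sup>+ z. epowr (ennreal (1 / \<mu> i) * h i z) p \<partial>lborel) =
        ennreal ((1 / \<mu> i) powr p) * (\<integral>\<^sup>+ z. epowr (h i z) p \<partial>lborel)"
      using \<mu>[of i] by (simp add: epowr_mult epowr_ennreal nn_integral_cmult)
    also have "\<dots> \<le> ennreal ((1 / \<mu> i) powr p) * ennreal ((\<mu> i * ?B i) powr p)"
      by (intro mult_left_mono bound) simp
    also have "\<dots> = ennreal ((1 / \<mu> i * (\<mu> i * ?B i)) powr p)"
      using \<mu>[of i] by (subst powr_mult) (simp_all add: ennreal_mult)
    also have "1 / \<mu> i * (\<mu> i * ?B i) = ?B i" using \<mu>[of i] by simp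
    finally show ?thesis .
  qed
  have finD: "AE z in lborel. ?D z < top"
    by (rule AE_series_finite[OF I(1) p c \<mu> h supp, where B = "\<lambda>k l. (2 powr (- (\<alpha> + lam) * real_of_int (k + l))) powr p"])
      (use bound' S in auto)
  show "AE z in lborel. F z < top"
    using finD dom by eventually_elim (rule le_less_trans)
  \<comment> \<open>Representations are sequences; an infinite countable index type is in bijection
    with the naturals.\<close>
  define \<nu> where "\<nu> = from_nat_into (UNIV :: 'i set)"
  have bij: "bij_betw \<nu> UNIV UNIV" unfolding \<nu>_def using I by (rule bij_betw_from_nat_into)
  \<comment> \<open>Where the domination holds with \<open>?D\<close> finite and positive, the cut
    at 1 changes nothing. Elsewhere it keeps the factor at most 1, so that every \<open>b n\<close>
    inherits the bound of its \<open>h\<close>.\<close>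
  define \<theta> where "\<theta> z = min 1 (F z / ?D z)" for z
  have [measurable]: "\<theta> \<in> borel_measurable borel" unfolding \<theta>_def by measurable
  define b where "b n z = complex_of_real (enn2real (\<theta> z * (ennreal (1 / \<mu> (\<nu> n)) * h (\<nu> n) z)))" for n z
  define c' where "c' n = complex_of_real (c (\<nu> n) * \<mu> (\<nu> n))" for n
  have c'_norm: "norm (c' n) = c (\<nu> n) * \<mu> (\<nu> n)" for n
    using c[of "\<nu> n"] \<mu>[of "\<nu> n"] by (simp add: c'_def norm_mult del: of_real_mult)
  have c'_sums: "(\<lambda>n. norm (c' n)) sums S"
  proof -
    have "(\<Sum>n. ennreal (norm (c' n))) = ennreal S"
      unfolding c'_norm S(1)[symmetric] nn_integral_count_space_nat[symmetric]
      by (rule nn_integral_bij_count_space[OF bij])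
    from sums_enn2real[OF _ this] show ?thesis using S(2) by simp
  qed
  have "herz_block \<alpha> p q lam (b n)" for n
  proof -
    have "b n \<in> borel_measurable borel" unfolding b_def by measurable
    then have meas: "b n \<in> borel_measurable lebesgue" by (intro measurable_completion) simp
    have supp_b: "b n z = 0" if "z \<notin> dyadic_shell (s (\<nu> n)) \<times> dyadic_shell (t (\<nu> n))" for z
      using supp[OF that] by (simp add: b_def)
    have rect: "b n z = 0" if "z \<notin> dyadic_rect (s (\<nu> n)) (t (\<nu> n))" for z
      by (rule supp_b) (use that in \<open>auto simp: dyadic_rect_def dyadic_shell_def\<close>)
    have "\<theta> z * y \<le> y" for z y
      unfolding \<theta>_def by (rule order_trans[OF mult_right_mono[of _ 1]]) auto
    then have "(\<integral>\<^sup>+ z. ennreal (norm (b n z) powr p) \<partial>lborel) \<le>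
        (\<integral>\<^sup>+ z. epowr (ennreal (1 / \<mu> (\<nu> n)) * h (\<nu> n) z) p \<partial>lborel)"
      unfolding b_def using p by (intro nn_integral_mono ennreal_norm_powr_le_epowr) auto
    also note bound'
    finally have "herz_norm \<alpha> p q (b n) \<le> ennreal (2 powr (real_of_int (s (\<nu> n) + t (\<nu> n)) * \<alpha>) * ?B (\<nu> n))"
      using p q by (intro herz_norm_le_of_single_shell supp_b) auto
    also have "2 powr (real_of_int (s (\<nu> n) + t (\<nu> n)) * \<alpha>) * ?B (\<nu> n) = 2 powr (- lam * real_of_int (s (\<nu> n) + t (\<nu> n)))"
      unfolding powr_add[symmetric] by (rule arg_cong[where f = "\<lambda>x. 2 powr x"]) (simp add: algebra_simps)
    finally have "herz_norm \<alpha> p q (b n) \<le> ennreal (2 powr (- lam * real_of_int (s (\<nu> n) + t (\<nu> n))))" .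
    then show ?thesis unfolding herz_block_def using meas rect by blast
  qed
  moreover have "AE z in lebesgue. (\<lambda>n. c' n * b n z) sums complex_of_real (enn2real (F z))"
    unfolding AE_completion_iff[of _ lborel]
    using finD dom
  proof eventually_elim
    case (elim z)
    define r where "r n = c (\<nu> n) * \<mu> (\<nu> n) * enn2real (\<theta> z * (ennreal (1 / \<mu> (\<nu> n)) * h (\<nu> n) z))" for n
    have \<theta>: "\<theta> z \<le> 1" by (simp add: \<theta>_def)
    have r0: "0 \<le> r n" for n using c[of "\<nu> n"] \<mu>[of "\<nu> n"] by (simp add: r_def)
    \<comment> \<open>\<open>enn2real\<close> is faithful only on finite values. If \<open>c\<close>
      vanishes both sides are 0; otherwise finiteness of \<open>?D z\<close> forces \<open>h\<close>
      to be finite at \<open>z\<close>.\<close>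
    have r: "ennreal (r n) = \<theta> z * (ennreal (c (\<nu> n)) * h (\<nu> n) z)" for n
    proof (cases "c (\<nu> n) = 0")
      case True
      then show ?thesis by (simp add: r_def)
    next
      case False
      have "ennreal (c (\<nu> n)) * h (\<nu> n) z \<le> ?D z"
        by (rule nn_integral_ge_point) simp
      then have "ennreal (c (\<nu> n)) * h (\<nu> n) z < top" using elim(1) by (rule le_less_trans)
      then have fin: "h (\<nu> n) z < top"
        using False c[of "\<nu> n"] by (auto simp: ennreal_mult_less_top ennreal_mult_eq_top_iff less_top[symmetric])
      let ?X = "\<theta> z * (ennreal (1 / \<mu> (\<nu> n)) * h (\<nu> n) z)"
      have "?X < top" using fin \<theta> by (auto simp: ennreal_mult_less_top intro: le_less_trans)
      then have "ennreal (r n) = ennreal (c (\<nu> n) * \<mu> (\<nu> n)) * ?X"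
        using c[of "\<nu> n"] \<mu>[of "\<nu> n"] by (simp add: r_def ennreal_mult)
      also have "\<dots> = \<theta> z * (ennreal (c (\<nu> n)) * (ennreal (\<mu> (\<nu> n)) * ennreal (1 / \<mu> (\<nu> n))) * h (\<nu> n) z)"
        using c[of "\<nu> n"] \<mu>[of "\<nu> n"] by (simp only: ennreal_mult less_imp_le mult_ac)
      also have "ennreal (\<mu> (\<nu> n)) * ennreal (1 / \<mu> (\<nu> n)) = 1"
        using \<mu>[of "\<nu> n"] by (simp add: ennreal_mult[symmetric])
      finally show ?thesis by simp
    qed
    have "(\<Sum>n. ennreal (r n)) = \<theta> z * (\<Sum>n. ennreal (c (\<nu> n)) * h (\<nu> n) z)"
      unfolding r by (rule ennreal_suminf_cmult)
    also have "(\<Sum>n. ennreal (c (\<nu> n)) * h (\<nu> n) z) = ?D z"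
      unfolding nn_integral_count_space_nat[symmetric] by (rule nn_integral_bij_count_space[OF bij])
    also have "\<theta> z * ?D z = F z"
    proof (cases "?D z = 0")
      case True
      then show ?thesis using elim(2) by simp
    next
      case False
      then have pos: "0 < ?D z" by (simp add: zero_less_iff_neq_zero)
      have "F z / ?D z \<le> 1" using elim(2) by (subst ennreal_divide_le_iff[OF pos elim(1)]) simp
      then have "\<theta> z = F z / ?D z" by (simp add: \<theta>_def min_def)
      then show ?thesis using pos elim(1) by (simp add: ennreal_divide_times mult_divide_eq_ennreal)
    qed
    finally have "(\<Sum>n. ennreal (r n)) = F z" .
    then have "r sums enn2real (F z)"
      using r0 elim by (intro sums_enn2real) (auto intro: le_less_trans)
    then have "(\<lambda>n. complex_of_real (r n)) sums complex_of_real (enn2real (F z))"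
      by (rule sums_of_real)
    then show ?case by (simp add: r_def c'_def b_def)
  qed
  ultimately have "block_rep \<alpha> p q lam (\<lambda>z. complex_of_real (enn2real (F z))) c' b"
    using c'_sums by (simp add: block_rep_def sums_iff)
  moreover have "(\<Sum>n. norm (c' n)) = S" using c'_sums by (simp add: sums_iff)
  ultimately show "\<exists>c' b. block_rep \<alpha> p q lam (\<lambda>z. complex_of_real (enn2real (F z))) c' b \<and> (\<Sum>n. norm (c' n)) = S"
    by blast
qed

section \<open>The strong maximal operator on block series\<close>

lemma nn_integral_count_space_mult:
  fixes F :: "'a \<Rightarrow> ennreal" and G :: "'b \<Rightarrow> ennreal"
  shows "(\<integral>\<^sup>+ x. F (fst x) * G (snd x) \<partial>count_space UNIV) =
    (\<integral>\<^sup>+ x. F x \<partial>count_space UNIV) * (\<integral>\<^sup>+ y. G y \<partial>count_space UNIV)"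
  by (simp add: nn_integral_fst_count_space[symmetric] nn_integral_cmult nn_integral_multc)

text \<open>Loss factor for moving by \<open>e\<close> shells: the norm of the maximal operator
  times the change of the block normalisation, used with \<beta> = \<alpha> + lam.\<close>

definition shell_weight :: "real \<Rightarrow> real \<Rightarrow> real \<Rightarrow> int \<Rightarrow> real" where
  "shell_weight d p \<beta> e = shell_decay d p e powr (1 / p) * 2 powr (\<beta> * real_of_int e)"

lemma shell_weight_pos: "0 < shell_weight d p \<beta> e"
  using shell_decay_pos[of d p e] by (simp add: shell_weight_def)

text \<open>The weights are geometric on either side of 0, with rates d (1 - 1 / p) - \<beta>
  outwards and d / p + \<beta> inwards; the two hypotheses say that both rates are positive.\<close>

lemma shell_weight_summable:
  assumes p: "1 < p" and \<beta>: "- d / p < \<beta>" "\<beta> < d * (1 - 1 / p)"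
  shows "(\<integral>\<^sup>+ e. ennreal (shell_weight d p \<beta> e) \<partial>count_space UNIV) < top"
proof -
  have 1: "shell_weight d p \<beta> (int n) = 2 powr (- (d * (1 - 1 / p) - \<beta>) * real n)" for n
  proof -
    have "- (real n) * d * (p - 1) * (1 / p) + \<beta> * real n = - (d * (1 - 1 / p) - \<beta>) * real n"
      using p by (simp add: field_simps)
    then show ?thesis
      by (simp only: shell_weight_def shell_decay_def powr_powr powr_add[symmetric] of_int_of_nat_eq of_nat_0_le_iff if_True)
  qed
  have 2: "shell_weight d p \<beta> (- int n) = 2 powr (- (d / p + \<beta>) * real n)" for n
  proof (cases "n = 0")
    case True
    then show ?thesis by (simp add: shell_weight_def shell_decay_def)
  next
    case False
    have "- real n * d * (1 / p) + \<beta> * (- real n) = - (d / p + \<beta>) * real n"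
      using p by (simp add: field_simps)
    then show ?thesis using False
      by (simp add: shell_weight_def shell_decay_def powr_powr powr_add[symmetric])
  qed
  have "0 < d * (1 - 1 / p) - \<beta>" "0 < d / p + \<beta>" using \<beta> by auto
  then have "(\<Sum>n. ennreal (shell_weight d p \<beta> (int n))) + (\<Sum>n. ennreal (shell_weight d p \<beta> (- int n))) < top"
    unfolding 1 2 by (simp only: suminf_ennreal_powr_geometric ennreal_add_eq_top less_top) simp
  then show ?thesis using nn_integral_int_le by (rule le_less_trans[rotated])
qed

text \<open>A shell that meets the cube of index l has index at most l, so natural numbers measure
  the depth below (l1, l2). Each piece keeps the norm bound of the full rectangle, which later
  yields the decay in the depth.\<close>

lemma herz_block_shell_decomposition:
  fixes b :: "(real ^ 'n) \<times> (real ^ 'm) \<Rightarrow> complex"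
  assumes p: "0 < p" and q: "0 < q" and b: "herz_block \<alpha> p q lam b"
  shows "\<exists>l1 l2 (G :: nat \<times> nat \<Rightarrow> (real ^ 'n) \<times> (real ^ 'm) \<Rightarrow> ennreal).
    (\<forall>x. G x \<in> borel_measurable borel) \<and>
    (\<forall>x z. z \<notin> dyadic_shell (l1 - int (fst x)) \<times> dyadic_shell (l2 - int (snd x)) \<longrightarrow> G x z = 0) \<and>
    (\<forall>x. (\<integral>\<^sup>+ z. epowr (G x z) p \<partial>lborel) \<le>
      ennreal ((2 powr (- real_of_int (l1 - int (fst x) + (l2 - int (snd x))) * \<alpha>) * 2 powr (- lam * real_of_int (l1 + l2))) powr p)) \<and>
    (AE z in lborel. ennreal (norm (b z)) \<le> (\<integral>\<^sup>+ x. G x z \<partial>count_space UNIV))"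
proof -
  obtain l1 l2 where l: "\<And>z. z \<notin> dyadic_rect l1 l2 \<Longrightarrow> b z = 0"
    "herz_norm \<alpha> p q b \<le> ennreal (2 powr (- lam * real_of_int (l1 + l2)))"
    and meas: "b \<in> borel_measurable lebesgue"
    using b unfolding herz_block_def by blast
  have "(\<lambda>z. ennreal (norm (b z))) \<in> borel_measurable lebesgue" using meas by measurable
  \<comment> \<open>Blocks are only Lebesgue measurable, while the Tonelli arguments work with Borel
    functions; the modulus is replaced by a Borel version.\<close>
  then obtain g where g[measurable]: "g \<in> borel_measurable lborel"
      and eq: "AE z in lborel. ennreal (norm (b z)) = g z"
    using completion_ex_borel_measurable by blast
  have [measurable]: "g \<in> borel_measurable borel" using g by simp
  let ?E = "\<lambda>x. dyadic_shell (l1 - int (fst x)) \<times> dyadic_shell (l2 - int (snd x)) :: ((real ^ 'n) \<times> (real ^ 'm)) set"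
  define G where "G x z = g z * indicator (?E x) z" for x z
  have "?E x \<in> sets borel" for x by (simp add: borel_prod[symmetric])
  then have "G x \<in> borel_measurable borel" for x unfolding G_def by measurable
  moreover have "G x z = 0" if "z \<notin> ?E x" for x z using that by (simp add: G_def)
  moreover have "(\<integral>\<^sup>+ z. epowr (G x z) p \<partial>lborel) \<le>
      ennreal ((2 powr (- real_of_int (l1 - int (fst x) + (l2 - int (snd x))) * \<alpha>) * 2 powr (- lam * real_of_int (l1 + l2))) powr p)" for x
  proof -
    have "(\<integral>\<^sup>+ z. epowr (G x z) p \<partial>lborel) = (\<integral>\<^sup>+ z. ennreal (norm (b z * indicator (?E x) z) powr p) \<partial>lborel)"
    proof (rule nn_integral_cong_AE)
      show "AE z in lborel. epowr (G x z) p = ennreal (norm (b z * indicator (?E x) z) powr p)"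
        using eq
      proof eventually_elim
        case (elim z)
        show ?case
        proof (cases "z \<in> ?E x")
          case True
          then show ?thesis unfolding G_def elim[symmetric] by (simp add: epowr_ennreal)
        next
          case False
          then show ?thesis by (simp add: G_def)
        qed
      qed
    qed
    also have "\<dots> \<le> ennreal ((2 powr (- real_of_int (l1 - int (fst x) + (l2 - int (snd x))) * \<alpha>) * 2 powr (- lam * real_of_int (l1 + l2))) powr p)"
      using l(2) by (intro Lp_norm_shell_le_of_herz_norm_le[OF p q]) auto
    finally show ?thesis .
  qed
  moreover have "AE z in lborel. ennreal (norm (b z)) \<le> (\<integral>\<^sup>+ x. G x z \<partial>count_space UNIV)"
    using eq AE_coordinates_nonzero
  proof eventually_elim
    case (elim z)
    show ?case
    proof (cases "z \<in> dyadic_rect l1 l2")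
      case False
      then show ?thesis using l(1) by simp
    next
      case True
      then have cubes: "fst z \<in> dyadic_cube l1" "snd z \<in> dyadic_cube l2"
        by (auto simp: dyadic_rect_def)
      obtain k1 k2 where k: "fst z \<in> dyadic_shell k1" "snd z \<in> dyadic_shell k2"
        using elim(2) ex_dyadic_shell by meson
      have "k1 \<le> l1" "k2 \<le> l2"
        using dyadic_shell_le_of_mem_cube[OF k(1) cubes(1)] dyadic_shell_le_of_mem_cube[OF k(2) cubes(2)] by auto
      then have "z \<in> ?E (nat (l1 - k1), nat (l2 - k2))" using k by (simp add: mem_Times_iff)
      then have "ennreal (norm (b z)) = G (nat (l1 - k1), nat (l2 - k2)) z"
        using elim(1) by (simp only: G_def indicator_simps mult_1_right)
      also have "\<dots> \<le> (\<integral>\<^sup>+ x. G x z \<partial>count_space UNIV)" by (rule nn_integral_ge_point) simp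
      finally show ?thesis .
    qed
  qed
  ultimately show ?thesis by (intro exI[of _ l1] exI[of _ l2] exI[of _ G]) blast
qed

lemma ennreal_norm_sums_le:
  fixes a :: "nat \<Rightarrow> 'a::banach"
  assumes "a sums s"
  shows "ennreal (norm s) \<le> (\<Sum>n. ennreal (norm (a n)))"
proof (cases "(\<Sum>n. ennreal (norm (a n))) = top")
  case False
  then have "summable (\<lambda>n. norm (a n))" by (intro summable_suminf_not_top) auto
  then have "norm s \<le> (\<Sum>n. norm (a n))" "(\<Sum>n. ennreal (norm (a n))) = ennreal (\<Sum>n. norm (a n))"
    using summable_norm[of a] assms by (auto simp: sums_iff suminf_ennreal2)
  then show ?thesis by (simp add: ennreal_leI)
qed simp

text \<open>\<open>C\<close> is independent of the representation: the weights of the dominating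
  series factor over its index, so their total is exactly \<open>C\<close> times the given
  coefficient sum. This is the form needed for passing to the infimum.\<close>

lemma strong_maximal_block_rep:
  fixes \<alpha> p q lam :: real
  assumes p: "1 < p" and q: "0 < q" and lam: "0 < lam"
    and n: "- real CARD('n) / p < \<alpha> + lam" "\<alpha> + lam < real CARD('n) * (1 - 1 / p)"
    and m: "- real CARD('m) / p < \<alpha> + lam" "\<alpha> + lam < real CARD('m) * (1 - 1 / p)"
  shows "\<exists>C\<ge>0. \<forall>(f :: (real ^ 'n) \<times> (real ^ 'm) \<Rightarrow> complex) c b. block_rep \<alpha> p q lam f c b \<longrightarrow>
    (AE z in lborel. strong_maximal f z < top) \<and>
    (\<exists>c' b'. block_rep \<alpha> p q lam (\<lambda>z. complex_of_real (enn2real (strong_maximal f z))) c' b' \<and>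
      (\<Sum>k. norm (c' k)) = C * (\<Sum>k. norm (c k)))"
proof -
  let ?n = "real CARD('n)" and ?m = "real CARD('m)"
  define \<beta> where "\<beta> = \<alpha> + lam"
  obtain K where K: "0 < K" and est: "\<And>(g :: (real ^ 'n) \<times> (real ^ 'm) \<Rightarrow> ennreal) i j k l.
    g \<in> borel_measurable (borel \<Otimes>\<^sub>M borel) \<Longrightarrow>
    (\<And>z. z \<notin> dyadic_shell i \<times> dyadic_shell j \<Longrightarrow> g z = 0) \<Longrightarrow>
    (\<integral>\<^sup>+ z \<in> dyadic_shell k \<times> dyadic_shell l. epowr (iterated_maximal g z) p \<partial>lborel) \<le>
      ennreal (K * shell_decay ?n p (k - i) * shell_decay ?m p (l - j)) * (\<integral>\<^sup>+ z. epowr (g z) p \<partial>lborel)"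
    using iterated_maximal_shell_estimate[OF p, where 'n = 'n and 'm = 'm] by auto
  define Wn where "Wn = enn2real (\<integral>\<^sup>+ e. ennreal (shell_weight ?n p \<beta> e) \<partial>count_space UNIV)"
  define Wm where "Wm = enn2real (\<integral>\<^sup>+ e. ennreal (shell_weight ?m p \<beta> e) \<partial>count_space UNIV)"
  have Wn: "(\<integral>\<^sup>+ e. ennreal (shell_weight ?n p \<beta> e) \<partial>count_space UNIV) = ennreal Wn"
    unfolding Wn_def using shell_weight_summable[OF p n] by (simp add: \<beta>_def)
  have Wm: "(\<integral>\<^sup>+ e. ennreal (shell_weight ?m p \<beta> e) \<partial>count_space UNIV) = ennreal Wm"
    unfolding Wm_def using shell_weight_summable[OF p m] by (simp add: \<beta>_def)
  have W0: "0 \<le> Wn" "0 \<le> Wm" by (simp_all add: Wn_def Wm_def)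
  define g where "g = 1 / (1 - 2 powr (- lam))"
  have g: "(\<integral>\<^sup>+ a. ennreal (2 powr (- lam * real a)) \<partial>count_space UNIV) = ennreal g"
    unfolding g_def nn_integral_count_space_nat by (rule suminf_ennreal_powr_geometric[OF lam])
  have g0: "0 \<le> g" using lam by (simp add: g_def powr_less_one less_imp_le)
  \<comment> \<open>One \<open>g\<close> for each of the two sums over the depth, \<open>Wn\<close>
    and \<open>Wm\<close> for the shifts, and the p-th root of the constant of the shell
    estimate.\<close>
  define C where "C = g * g * (K powr (1 / p) * (Wn * Wm))"
  have C: "0 \<le> C" using g0 W0 by (simp add: C_def)
  have "(AE z in lborel. strong_maximal f z < top) \<and>
      (\<exists>c' b'. block_rep \<alpha> p q lam (\<lambda>z. complex_of_real (enn2real (strong_maximal f z))) c' b' \<and>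
        (\<Sum>k. norm (c' k)) = C * (\<Sum>k. norm (c k)))"
    if rep: "block_rep \<alpha> p q lam f c b" for f :: "(real ^ 'n) \<times> (real ^ 'm) \<Rightarrow> complex" and c b
  proof -
    have sm: "summable (\<lambda>k. norm (c k))" and bl: "\<And>k. herz_block \<alpha> p q lam (b k)"
      and sums: "AE z in lborel. (\<lambda>k. c k * b k z) sums f z"
      using rep by (auto simp: block_rep_def AE_completion_iff)
    have "\<forall>k. \<exists>l1 l2 (G :: nat \<times> nat \<Rightarrow> (real ^ 'n) \<times> (real ^ 'm) \<Rightarrow> ennreal).
      (\<forall>x. G x \<in> borel_measurable borel) \<and>
      (\<forall>x z. z \<notin> dyadic_shell (l1 - int (fst x)) \<times> dyadic_shell (l2 - int (snd x)) \<longrightarrow> G x z = 0) \<and>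
      (\<forall>x. (\<integral>\<^sup>+ z. epowr (G x z) p \<partial>lborel) \<le>
        ennreal ((2 powr (- real_of_int (l1 - int (fst x) + (l2 - int (snd x))) * \<alpha>) * 2 powr (- lam * real_of_int (l1 + l2))) powr p)) \<and>
      (AE z in lborel. ennreal (norm (b k z)) \<le> (\<integral>\<^sup>+ x. G x z \<partial>count_space UNIV))"
      using herz_block_shell_decomposition[OF _ q bl] p by simp
    then obtain l1 l2 and G :: "nat \<Rightarrow> nat \<times> nat \<Rightarrow> (real ^ 'n) \<times> (real ^ 'm) \<Rightarrow> ennreal"
      where dec: "\<forall>k. (\<forall>x. G k x \<in> borel_measurable borel) \<and>
      (\<forall>x z. z \<notin> dyadic_shell (l1 k - int (fst x)) \<times> dyadic_shell (l2 k - int (snd x)) \<longrightarrow> G k x z = 0) \<and>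
      (\<forall>x. (\<integral>\<^sup>+ z. epowr (G k x z) p \<partial>lborel) \<le>
        ennreal ((2 powr (- real_of_int (l1 k - int (fst x) + (l2 k - int (snd x))) * \<alpha>) * 2 powr (- lam * real_of_int (l1 k + l2 k))) powr p)) \<and>
      (AE z in lborel. ennreal (norm (b k z)) \<le> (\<integral>\<^sup>+ x. G k x z \<partial>count_space UNIV))"
      unfolding choice_iff by (elim exE) (rule that)
    then have G_meas: "\<And>k x. G k x \<in> borel_measurable borel"
      and G_supp: "\<And>k x z. z \<notin> dyadic_shell (l1 k - int (fst x)) \<times> dyadic_shell (l2 k - int (snd x)) \<Longrightarrow> G k x z = 0"
      and G_bound: "\<And>k x. (\<integral>\<^sup>+ z. epowr (G k x z) p \<partial>lborel) \<le>
        ennreal ((2 powr (- real_of_int (l1 k - int (fst x) + (l2 k - int (snd x))) * \<alpha>) * 2 powr (- lam * real_of_int (l1 k + l2 k))) powr p)"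
      and G_dom: "\<And>k. AE z in lborel. ennreal (norm (b k z)) \<le> (\<integral>\<^sup>+ x. G k x z \<partial>count_space UNIV)"
      by blast+
    have G_meas'[measurable]: "G k x \<in> borel_measurable (borel \<Otimes>\<^sub>M borel)" for k x
      using G_meas by (simp add: borel_prod)
    \<comment> \<open>An index ((k, a, a'), e, e') consists of the block, the depths of the piece in
      its rectangle, and the shifts to the target shell (s, t).\<close>
    define s where "s \<iota> = l1 (fst (fst \<iota>)) - int (fst (snd (fst \<iota>))) + fst (snd \<iota>)"
      for \<iota> :: "(nat \<times> nat \<times> nat) \<times> int \<times> int"
    define t where "t \<iota> = l2 (fst (fst \<iota>)) - int (snd (snd (fst \<iota>))) + snd (snd \<iota>)"
      for \<iota> :: "(nat \<times> nat \<times> nat) \<times> int \<times> int"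
    define E where "E \<iota> = (dyadic_shell (s \<iota>) \<times> dyadic_shell (t \<iota>) :: ((real ^ 'n) \<times> (real ^ 'm)) set)" for \<iota>
    define h where "h \<iota> z = iterated_maximal (G (fst (fst \<iota>)) (snd (fst \<iota>))) z * indicator (E \<iota>) z" for \<iota> z
    \<comment> \<open>The multiple of a block on its own shell that the piece \<open>h\<close>
      amounts to: depth gain, operator norm and change of normalisation.\<close>
    define \<mu> where "\<mu> \<iota> = 2 powr (- lam * real (fst (snd (fst \<iota>)))) * 2 powr (- lam * real (snd (snd (fst \<iota>)))) *
      (K powr (1 / p) * (shell_weight ?n p \<beta> (fst (snd \<iota>)) * shell_weight ?m p \<beta> (snd (snd \<iota>))))"
      for \<iota> :: "(nat \<times> nat \<times> nat) \<times> int \<times> int"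
    have E_meas: "E \<iota> \<in> sets borel" for \<iota> by (simp add: E_def borel_prod[symmetric])
    have h_meas: "h \<iota> \<in> borel_measurable borel" for \<iota>
    proof -
      note E_meas[of \<iota>, measurable]
      have [measurable]: "iterated_maximal (G k x) \<in> borel_measurable borel" for k x
        using iterated_maximal_measurable[OF G_meas'] by (simp add: borel_prod)
      show ?thesis unfolding h_def by measurable
    qed
    have \<mu>: "0 < \<mu> \<iota>" for \<iota>
      using K shell_weight_pos by (simp add: \<mu>_def)
    have h_bound: "(\<integral>\<^sup>+ z. epowr (h \<iota> z) p \<partial>lborel) \<le>
        ennreal ((\<mu> \<iota> * 2 powr (- (\<alpha> + lam) * real_of_int (s \<iota> + t \<iota>))) powr p)" for \<iota>
    proof -
      obtain k a a' e e' where \<iota>: "\<iota> = ((k, a, a'), e, e')" by (cases \<iota>) auto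
      let ?u = "- real_of_int (l1 k - int a + (l2 k - int a')) * \<alpha>" and ?v = "- lam * real_of_int (l1 k + l2 k)"
      let ?dn = "shell_decay ?n p e" and ?dm = "shell_decay ?m p e'"
      have "(\<integral>\<^sup>+ z. epowr (h \<iota> z) p \<partial>lborel) = (\<integral>\<^sup>+ z \<in> dyadic_shell (s \<iota>) \<times> dyadic_shell (t \<iota>).
          epowr (iterated_maximal (G k (a, a')) z) p \<partial>lborel)"
        by (intro nn_integral_cong) (simp add: h_def E_def \<iota> indicator_def)
      also have "\<dots> \<le> ennreal (K * shell_decay ?n p (s \<iota> - (l1 k - int a)) * shell_decay ?m p (t \<iota> - (l2 k - int a'))) *
          (\<integral>\<^sup>+ z. epowr (G k (a, a') z) p \<partial>lborel)"
        by (rule est[OF G_meas']) (use G_supp[of _ k "(a, a')"] in auto)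
      also have "\<dots> = ennreal (K * ?dn * ?dm) * (\<integral>\<^sup>+ z. epowr (G k (a, a') z) p \<partial>lborel)"
        by (simp add: s_def t_def \<iota>)
      also have "\<dots> \<le> ennreal (K * ?dn * ?dm) * ennreal ((2 powr ?u * 2 powr ?v) powr p)"
        using G_bound[of k "(a, a')"] by (intro mult_left_mono) auto
      also have "\<dots> = ennreal (K * ?dn * ?dm * (2 powr ?u * 2 powr ?v) powr p)"
        using K shell_decay_pos[of ?n p e] shell_decay_pos[of ?m p e'] by (simp add: ennreal_mult)
      also have "K * ?dn * ?dm * (2 powr ?u * 2 powr ?v) powr p =
          (\<mu> \<iota> * 2 powr (- (\<alpha> + lam) * real_of_int (s \<iota> + t \<iota>))) powr p"
      proof -
        \<comment> \<open>As s + t = l1 + l2 - a - a' + e + e', the choice \<beta> = \<alpha> + lam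
          cancels the shifts, and lam (a + a') turns the normalisation at the piece's shell into
          that of the full rectangle.\<close>
        have "2 powr (- lam * real a) * 2 powr (- lam * real a') * (2 powr (\<beta> * real_of_int e) * 2 powr (\<beta> * real_of_int e')) *
            2 powr (- (\<alpha> + lam) * real_of_int (s \<iota> + t \<iota>)) = 2 powr ?u * 2 powr ?v"
          unfolding powr_add[symmetric]
          by (rule arg_cong[where f = "\<lambda>x. 2 powr x"]) (simp add: s_def t_def \<iota> \<beta>_def algebra_simps)
        moreover have "x * y * (k * (dn * en * (dm * em))) * w = k * dn * dm * (x * y * (en * em) * w)"
          for x y k dn en dm em w :: real by (simp only: mult_ac)
        ultimately have "\<mu> \<iota> * 2 powr (- (\<alpha> + lam) * real_of_int (s \<iota> + t \<iota>)) =
            K powr (1 / p) * ?dn powr (1 / p) * ?dm powr (1 / p) * (2 powr ?u * 2 powr ?v)"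
          by (simp only: \<mu>_def \<iota> fst_conv snd_conv shell_weight_def)
        then show ?thesis
          using p K shell_decay_pos[of ?n p e] shell_decay_pos[of ?m p e']
          by (simp add: powr_mult powr_powr)
      qed
      finally show ?thesis .
    qed
    have S: "(\<integral>\<^sup>+ \<iota>. ennreal (norm (c (fst (fst \<iota>))) * \<mu> \<iota>) \<partial>count_space UNIV) = ennreal (C * (\<Sum>k. norm (c k)))"
    proof -
      have "ennreal (norm (c (fst (fst \<iota>))) * \<mu> \<iota>) =
          (ennreal (norm (c (fst (fst \<iota>)))) * (ennreal (2 powr (- lam * real (fst (snd (fst \<iota>))))) *
            ennreal (2 powr (- lam * real (snd (snd (fst \<iota>))))))) *
          (ennreal (K powr (1 / p)) * (ennreal (shell_weight ?n p \<beta> (fst (snd \<iota>))) * ennreal (shell_weight ?m p \<beta> (snd (snd \<iota>)))))"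
        for \<iota> :: "(nat \<times> nat \<times> nat) \<times> int \<times> int"
        using shell_weight_pos[of ?n p \<beta> "fst (snd \<iota>)"] shell_weight_pos[of ?m p \<beta> "snd (snd \<iota>)"]
        by (simp add: \<mu>_def ennreal_mult mult.assoc less_imp_le)
      then have "(\<integral>\<^sup>+ \<iota>. ennreal (norm (c (fst (fst \<iota>))) * \<mu> \<iota>) \<partial>count_space UNIV) =
          (\<integral>\<^sup>+ x. ennreal (norm (c (fst x))) * (ennreal (2 powr (- lam * real (fst (snd x)))) *
            ennreal (2 powr (- lam * real (snd (snd x))))) \<partial>count_space UNIV) *
          (\<integral>\<^sup>+ y. ennreal (K powr (1 / p)) * (ennreal (shell_weight ?n p \<beta> (fst y)) * ennreal (shell_weight ?m p \<beta> (snd y))) \<partial>count_space UNIV)"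
        by (simp only: nn_integral_count_space_mult[of
          "\<lambda>x. ennreal (norm (c (fst x))) * (ennreal (2 powr (- lam * real (fst (snd x)))) * ennreal (2 powr (- lam * real (snd (snd x)))))"
          "\<lambda>y. ennreal (K powr (1 / p)) * (ennreal (shell_weight ?n p \<beta> (fst y)) * ennreal (shell_weight ?m p \<beta> (snd y)))"])
      also have "(\<integral>\<^sup>+ x. ennreal (norm (c (fst x))) * (ennreal (2 powr (- lam * real (fst (snd x)))) *
            ennreal (2 powr (- lam * real (snd (snd x))))) \<partial>count_space UNIV) =
          (\<integral>\<^sup>+ k. ennreal (norm (c k)) \<partial>count_space UNIV) * (\<integral>\<^sup>+ x. ennreal (2 powr (- lam * real (fst x))) *
            ennreal (2 powr (- lam * real (snd x))) \<partial>count_space UNIV)"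
        by (rule nn_integral_count_space_mult)
      also have "(\<integral>\<^sup>+ x. ennreal (2 powr (- lam * real (fst x))) * ennreal (2 powr (- lam * real (snd x))) \<partial>count_space UNIV) =
          ennreal g * ennreal g"
        unfolding g[symmetric] by (rule nn_integral_count_space_mult)
      also have "(\<integral>\<^sup>+ k. ennreal (norm (c k)) \<partial>count_space UNIV) = ennreal (\<Sum>k. norm (c k))"
        unfolding nn_integral_count_space_nat by (rule suminf_ennreal2) (use sm in auto)
      also have "(\<integral>\<^sup>+ y. ennreal (K powr (1 / p)) * (ennreal (shell_weight ?n p \<beta> (fst y)) * ennreal (shell_weight ?m p \<beta> (snd y))) \<partial>count_space UNIV) =
          ennreal (K powr (1 / p)) * (\<integral>\<^sup>+ y. ennreal (shell_weight ?n p \<beta> (fst y)) * ennreal (shell_weight ?m p \<beta> (snd y)) \<partial>count_space UNIV)"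
        by (rule nn_integral_cmult) simp
      also have "(\<integral>\<^sup>+ y. ennreal (shell_weight ?n p \<beta> (fst y)) * ennreal (shell_weight ?m p \<beta> (snd y)) \<partial>count_space UNIV) =
          ennreal Wn * ennreal Wm"
        unfolding Wn[symmetric] Wm[symmetric] by (rule nn_integral_count_space_mult)
      finally show ?thesis
        using suminf_nonneg[OF sm] g0 W0 by (simp add: C_def ennreal_mult[symmetric] mult_ac)
    qed
    have dom: "AE z in lborel. strong_maximal f z \<le> (\<integral>\<^sup>+ \<iota>. ennreal (norm (c (fst (fst \<iota>)))) * h \<iota> z \<partial>count_space UNIV)"
    proof -
      have "AE z in lborel. \<forall>k. ennreal (norm (b k z)) \<le> (\<integral>\<^sup>+ x. G k x z \<partial>count_space UNIV)"
        using G_dom by (simp add: AE_all_countable)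
      then have "AE w in lborel. ennreal (norm (f w)) \<le>
          (\<integral>\<^sup>+ y. ennreal (norm (c (fst y))) * G (fst y) (snd y) w \<partial>count_space UNIV)"
        using sums
      proof eventually_elim
        case (elim w)
        have "ennreal (norm (f w)) \<le> (\<Sum>k. ennreal (norm (c k * b k w)))"
          by (rule ennreal_norm_sums_le[OF elim(2)])
        also have "\<dots> = (\<integral>\<^sup>+ k. ennreal (norm (c k)) * ennreal (norm (b k w)) \<partial>count_space UNIV)"
          by (simp add: nn_integral_count_space_nat norm_mult ennreal_mult)
        also have "\<dots> \<le> (\<integral>\<^sup>+ k. ennreal (norm (c k)) * (\<integral>\<^sup>+ x. G k x w \<partial>count_space UNIV) \<partial>count_space UNIV)"
          using elim(1) by (intro nn_integral_mono mult_left_mono) auto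
        also have "\<dots> = (\<integral>\<^sup>+ y. ennreal (norm (c (fst y))) * G (fst y) (snd y) w \<partial>count_space UNIV)"
          by (simp add: nn_integral_fst_count_space[symmetric] nn_integral_cmult)
        finally show ?case .
      qed
      then have le: "strong_maximal f z \<le>
          (\<integral>\<^sup>+ y. ennreal (norm (c (fst y))) * iterated_maximal (G (fst y) (snd y)) z \<partial>count_space UNIV)" for z
        by (rule strong_maximal_le_nn_integral_iterated[rotated 2]) auto
      show ?thesis using AE_coordinates_nonzero
      proof eventually_elim
        case (elim z)
        obtain i j where ij: "fst z \<in> dyadic_shell i" "snd z \<in> dyadic_shell j"
          using elim ex_dyadic_shell by meson
        have "iterated_maximal (G (fst y) (snd y)) z \<le> (\<integral>\<^sup>+ x. h (y, x) z \<partial>count_space UNIV)" for y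
        proof -
          \<comment> \<open>The shift from the shell of the piece to the shell of \<open>z\<close>,
            so that a single term of the inner sum already gives the full value.\<close>
          let ?x = "(i - (l1 (fst y) - int (fst (snd y))), j - (l2 (fst y) - int (snd (snd y))))"
          have "z \<in> E (y, ?x)" using ij by (simp add: E_def s_def t_def mem_Times_iff)
          then have "iterated_maximal (G (fst y) (snd y)) z = h (y, ?x) z" by (simp add: h_def)
          also have "\<dots> \<le> (\<integral>\<^sup>+ x. h (y, x) z \<partial>count_space UNIV)" by (rule nn_integral_ge_point) simp
          finally show ?thesis .
        qed
        then have "(\<integral>\<^sup>+ y. ennreal (norm (c (fst y))) * iterated_maximal (G (fst y) (snd y)) z \<partial>count_space UNIV) \<le>
            (\<integral>\<^sup>+ y. ennreal (norm (c (fst y))) * (\<integral>\<^sup>+ x. h (y, x) z \<partial>count_space UNIV) \<partial>count_space UNIV)"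
          by (intro nn_integral_mono mult_left_mono) auto
        also have "\<dots> = (\<integral>\<^sup>+ \<iota>. ennreal (norm (c (fst (fst \<iota>)))) * h \<iota> z \<partial>count_space UNIV)"
          by (simp add: nn_integral_fst_count_space[symmetric] nn_integral_cmult)
        finally show ?case using le order_trans by blast
      qed
    qed
    have inf: "infinite (UNIV :: ((nat \<times> nat \<times> nat) \<times> int \<times> int) set)"
      by (simp add: finite_prod)
    have supp: "h \<iota> z = 0" if "z \<notin> dyadic_shell (s \<iota>) \<times> dyadic_shell (t \<iota>)" for \<iota> z
      using that by (simp add: h_def E_def)
    have S0: "0 \<le> C * (\<Sum>k. norm (c k))" using C suminf_nonneg[OF sm] by simp
    note concl = block_rep_of_dominated[where \<alpha> = \<alpha> and lam = lam, OF _ inf less_imp_le[OF p] q _ \<mu> h_meas supp h_bound S S0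
      strong_maximal_measurable dom]
    show ?thesis using concl by auto
  qed
  then show ?thesis using C by blast
qed

theorem theorem3p6:
  fixes \<alpha> p q p' lam :: real
  assumes "1 < p" and "1 < q" and "1 / p + 1 / p' = 1"
    and "0 < lam" and "lam < min (- \<alpha> + real CARD('n) / p') (- \<alpha> + real CARD('m) / p')"
    and "max (- real CARD('n) / p) (- real CARD('m) / p) < \<alpha>"
    and "\<alpha> < min (real CARD('n) * (1 - 1 / p)) (real CARD('m) * (1 - 1 / p))"
  shows "\<exists>C>0. \<forall>f \<in> (block_herz \<alpha> p q lam :: ((real ^ 'n) \<times> (real ^ 'm) \<Rightarrow> complex) set).
           (AE z in lebesgue. strong_maximal f z < \<infinity>) \<and>
           (\<lambda>z. complex_of_real (enn2real (strong_maximal f z))) \<in> block_herz \<alpha> p q lam \<and>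
           block_herz_norm \<alpha> p q lam (\<lambda>z. complex_of_real (enn2real (strong_maximal f z)))
             \<le> ennreal C * block_herz_norm \<alpha> p q lam f"
proof -
  have "1 - 1 / p = 1 / p'" using assms(3) by simp
  then have "real CARD('n) * (1 - 1 / p) = real CARD('n) / p'" "real CARD('m) * (1 - 1 / p) = real CARD('m) / p'"
    by simp_all
  then have *: "- real CARD('n) / p < \<alpha> + lam" "\<alpha> + lam < real CARD('n) * (1 - 1 / p)"
    "- real CARD('m) / p < \<alpha> + lam" "\<alpha> + lam < real CARD('m) * (1 - 1 / p)"
    using assms(4-6) by auto
  have "0 < q" using assms(2) by simp
  from strong_maximal_block_rep[where 'n = 'n and 'm = 'm, OF assms(1) this assms(4) *]
  obtain C where C: "0 \<le> C" and rep': "\<forall>(f :: (real ^ 'n) \<times> (real ^ 'm) \<Rightarrow> complex) c b. block_rep \<alpha> p q lam f c b \<longrightarrow>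
    (AE z in lborel. strong_maximal f z < top) \<and>
    (\<exists>c' b'. block_rep \<alpha> p q lam (\<lambda>z. complex_of_real (enn2real (strong_maximal f z))) c' b' \<and>
      (\<Sum>k. norm (c' k)) = C * (\<Sum>k. norm (c k)))"
    by (elim exE conjE)
  note rep = rep'[rule_format]
  show ?thesis
  \<comment> \<open>\<open>C\<close> is only known to be nonnegative, while a positive constant is
    required.\<close>
  proof (intro exI[of _ "C + 1"] conjI ballI)
    show "0 < C + 1" using C by simp
    fix f :: "(real ^ 'n) \<times> (real ^ 'm) \<Rightarrow> complex"
    let ?Mf = "\<lambda>z. complex_of_real (enn2real (strong_maximal f z))"
    assume "f \<in> block_herz \<alpha> p q lam"
    then obtain c b where cb: "block_rep \<alpha> p q lam f c b" by (auto simp: block_herz_def)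
    from rep[OF cb] show "AE z in lebesgue. strong_maximal f z < \<infinity>"
      by (simp add: AE_completion_iff)
    from rep[OF cb] show "?Mf \<in> block_herz \<alpha> p q lam"
      unfolding block_herz_def by blast
    have pos: "0 < ennreal (C + 1)" using \<open>0 < C + 1\<close> by (simp only: ennreal_less_zero_iff)
    \<comment> \<open>Dividing by the positive finite constant isolates the infimum over the
      representations of \<open>f\<close>, which can then be tested on one representation at a
      time.\<close>
    have "block_herz_norm \<alpha> p q lam ?Mf / ennreal (C + 1) \<le> block_herz_norm \<alpha> p q lam f"
      unfolding block_herz_norm_def[of _ _ _ _ f]
    proof (rule Inf_greatest)
      fix x assume "x \<in> {ennreal (\<Sum>k. norm (c k)) |c. \<exists>b. block_rep \<alpha> p q lam f c b}"
      then obtain c b where x: "x = ennreal (\<Sum>k. norm (c k))" and cb: "block_rep \<alpha> p q lam f c b" by blast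
      obtain c' b' where c': "block_rep \<alpha> p q lam ?Mf c' b'" "(\<Sum>k. norm (c' k)) = C * (\<Sum>k. norm (c k))"
        using rep[OF cb] by blast
      have "0 \<le> (\<Sum>k. norm (c k))" using cb by (intro suminf_nonneg) (auto simp: block_rep_def)
      have "block_herz_norm \<alpha> p q lam ?Mf \<le> ennreal (\<Sum>k. norm (c' k))"
        unfolding block_herz_norm_def using c'(1) by (intro Inf_lower) blast
      also have "\<dots> \<le> ennreal ((\<Sum>k. norm (c k)) * (C + 1))"
        unfolding c'(2) using \<open>0 \<le> (\<Sum>k. norm (c k))\<close> by (intro ennreal_leI) (simp add: algebra_simps)
      also have "\<dots> = x * ennreal (C + 1)"
        unfolding x using C \<open>0 \<le> (\<Sum>k. norm (c k))\<close> by (simp only: ennreal_mult add_nonneg_nonneg zero_le_one)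
      finally show "block_herz_norm \<alpha> p q lam ?Mf / ennreal (C + 1) \<le> x"
        unfolding ennreal_divide_le_iff[OF pos ennreal_less_top] .
    qed
    then show "block_herz_norm \<alpha> p q lam ?Mf \<le> ennreal (C + 1) * block_herz_norm \<alpha> p q lam f"
      unfolding ennreal_divide_le_iff[OF pos ennreal_less_top] mult.commute[of "ennreal (C + 1)"] .
  qed
qed

end
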